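(* There exists a universal constant $L>1$ with the following properties. (1) If $\gamma\subset\mathbb{R}^3$ is a $C^{1,1}$ $1$-manifold and $x\in\gamma$, then there exists a neighborhood $U\subset\gamma$ of $x$ such that $\mathrm{Lip}((U,d_K),\mathbb{R}^4)\le L$. (2) If $M\subset\mathbb{R}^3$ is a $C^{1,1}$ $2$-manifold and $x\in M$ is $\mathbb{H}$-regular, then there exists a neighborhood $U\subset M$ of $x$ such that $\mathrm{Lip}((U,d_K),\mathbb{R}^4)\le L$.
   Context: On $\mathbb{R}^3$ consider the vector fields $X=\partial_x-\tfrac12y\partial_z$, $Y=\partial_y+\tfrac12x\partial_z$; the horizontal plane at $p$ is $H_p=\mathrm{span}\{X(p),Y(p)\}$. For a $C^{1,1}$ $2$-manifold $M\subset\mathbb{R}^3$ and $p\in M$, $p$ is characteristic if $T_pM=H_p$, and $\mathbb{H}$-regular otherwise. The Korányi metric is $d_K(p,q)=\big(((x-x')^2+(y-y')^2)^2+16(z-z'+\tfrac12(xy'-x'y))^2\big)^{1/4}$ for $p=(x,y,z)$, $q=(x',y',z')$. $f:(X,d_X)\to(Y,d_Y)$ is $L$-bi-Lipschitz if $L^{-1}d_X(a,b)\le d_Y(f(a),f(b))\le Ld_X(a,b)$ for all $a,b$; $\mathrm{Lip}(X,Y)$ is the infimum of such $L$ over maps $X\to Y$. $\mathbb{R}^4$ has the Euclidean metric. *)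

theory Defs
  imports "HOL-Analysis.Analysis"
begin

definition horizontal_plane :: "real^3 \<Rightarrow> (real^3) set" where
  "horizontal_plane p =
     span {vector [1, 0, - (p$2) / 2], vector [0, 1, (p$1) / 2]}"

definition koranyi :: "real^3 \<Rightarrow> real^3 \<Rightarrow> real" where
  "koranyi p q =
     root 4 ((((p$1) - (q$1))^2 + ((p$2) - (q$2))^2)^2
             + 16 * ((p$3) - (q$3) + ((p$1) * (q$2) - (q$1) * (p$2)) / 2)^2)"

definition c11_chart ::
  "(real^3) set \<Rightarrow> (real^3) set \<Rightarrow> ('a::euclidean_space) set \<Rightarrow> ('a \<Rightarrow> real^3)
     \<Rightarrow> ('a \<Rightarrow> 'a \<Rightarrow> real^3) \<Rightarrow> bool" where
  "c11_chart M V W \<phi> \<phi>' \<longleftrightarrow>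
     open V \<and> open W \<and>
     (\<forall>w\<in>W. (\<phi> has_derivative \<phi>' w) (at w)) \<and>
     (\<forall>w\<in>W. inj (\<phi>' w)) \<and>
     (\<exists>C. \<forall>w1\<in>W. \<forall>w2\<in>W. onorm (\<lambda>v. \<phi>' w1 v - \<phi>' w2 v) \<le> C * dist w1 w2) \<and>
     (\<exists>\<psi>. homeomorphism W (M \<inter> V) \<phi> \<psi>)"

definition c11_curve :: "(real^3) set \<Rightarrow> bool" where
  "c11_curve M \<longleftrightarrow>
     (\<forall>p\<in>M. \<exists>V (W :: real set) \<phi> \<phi>'. p \<in> V \<and> c11_chart M V W \<phi> \<phi>')"

definition c11_surface :: "(real^3) set \<Rightarrow> bool" where
  "c11_surface M \<longleftrightarrow>
     (\<forall>p\<in>M. \<exists>V (W :: (real^2) set) \<phi> \<phi>'. p \<in> V \<and> c11_chart M V W \<phi> \<phi>')"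

text \<open>p is characteristic: the tangent plane T_pM (image of the derivative of a chart
  at the parameter of p) equals the horizontal plane H_p. The tangent plane does not
  depend on the chart.\<close>
definition characteristic :: "(real^3) set \<Rightarrow> real^3 \<Rightarrow> bool" where
  "characteristic M p \<longleftrightarrow>
     (\<exists>V (W :: (real^2) set) \<phi> \<phi>' w. c11_chart M V W \<phi> \<phi>' \<and> w \<in> W \<and> \<phi> w = p
        \<and> range (\<phi>' w) = horizontal_plane p)"

definition H_regular :: "(real^3) set \<Rightarrow> real^3 \<Rightarrow> bool" where
  "H_regular M p \<longleftrightarrow> p \<in> M \<and> \<not> characteristic M p"

definition bilipschitz_K :: "(real^3) set \<Rightarrow> real \<Rightarrow> (real^3 \<Rightarrow> real^4) \<Rightarrow> bool" where
  "bilipschitz_K U L f \<longleftrightarrow> L > 0 \<and>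
     (\<forall>a\<in>U. \<forall>b\<in>U. koranyi a b / L \<le> dist (f a) (f b) \<and> dist (f a) (f b) \<le> L * koranyi a b)"

definition Lip_K_R4 :: "(real^3) set \<Rightarrow> real" where
  "Lip_K_R4 U = Inf {L. \<exists>f. bilipschitz_K U L f}"

end

theory Submission
  imports Defs
begin

text \<open>
  Near an \<open>\<H>\<close>-regular point the horizontal planes cut the surface along curves, the leaves of a
  foliation directed by a Lipschitz line field. Let \<open>s\<close> be a parameter along the leaves and let \<open>\<psi>\<close>
  be a first integral. Along a short piece of a leaf the vertical term of the metric is dominated by
  the horizontal one, so near the point the Koranyi distance is comparable, with universal
  constants, to \<open>max \<bar>\<Delta>s\<bar> (sqrt \<bar>\<Delta>\<psi>\<bar>)\<close>. If \<open>K\<close> is a bi-Lipschitz embedding of the snowflake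
  \<open>(\<real>, \<bar>\<cdot>\<bar> powr (1/2))\<close> into \<open>\<real>\<^sup>3\<close>, the map \<open>(s, K \<psi>)\<close> into \<open>\<real>\<^sup>4\<close> is therefore bi-Lipschitz.
  The map \<open>K\<close> is a self-similar curve made of \<open>7\<^sup>2\<close> copies of itself scaled by \<open>1/7\<close>, that run through
  a chain of cubes in which cubes at least three steps apart do not touch.
  A curve always lies in such a surface: take the vertical cylinder over it or, if its tangent is
  vertical, the cylinder in the direction of the \<open>x\<close>-axis.
\<close>

section \<open>A self-similar curve of dimension two in space\<close>

text \<open>The constant must not depend on the point, on the Lipschitz constant of a chart's
  derivative or on the inclination of the surface. These data enter only through lower order terms,
  so they fix the size of the neighbourhood and nothing else: a horizontal shift of order
  \<open>\<tau>\<close> is negligible against \<open>sqrt \<bar>\<tau>\<bar>\<close> once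
  \<open>\<tau>\<close> is small. What survives is the slope \<open>\<beta>\<close> of the leaf
  direction, reduced to \<open>\<bar>\<beta>\<bar> \<le> 1\<close> by exchanging the horizontal
  coordinates, and the bounds 13 and 42 of the snowflake curve; together with the leaf estimates
  they fit under 200. With a merely Lipschitz line field the first integral need not be
  differentiable. It is enough that the gap between two leaves changes by a factor of at most 2
  along a short piece, which costs \<open>sqrt 2\<close> after the snowflake map. The exponent 1/2
  makes the image of \<open>K\<close> two-dimensional. The third dimension gives its distant pieces
  the room to stay apart, and with \<open>s\<close> this makes four coordinates.\<close>

type_synonym lattice = "int \<times> int \<times> int"

section \<open>Signed axes and orthogonal frames of the integer lattice\<close>

fun lsmul :: "int \<Rightarrow> lattice \<Rightarrow> lattice" where
  "lsmul k (x, y, z) = (k * x, k * y, k * z)"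

fun ldot :: "lattice \<Rightarrow> lattice \<Rightarrow> int" where
  "ldot (x, y, z) (x', y', z') = x * x' + y * y' + z * z'"

fun lcross :: "lattice \<Rightarrow> lattice \<Rightarrow> lattice" where
  "lcross (x, y, z) (x', y', z') = (y * z' - z * y', z * x' - x * z', x * y' - y * x')"

fun supn :: "lattice \<Rightarrow> int" where
  "supn (x, y, z) = max \<bar>x\<bar> (max \<bar>y\<bar> \<bar>z\<bar>)"

definition axes :: "lattice set" where
  "axes = {(1,0,0), (-1,0,0), (0,1,0), (0,-1,0), (0,0,1), (0,0,-1)}"

text \<open>For orthogonal axes \<open>d\<close> and \<open>e\<close> this is a rotation of the
  lattice. It preserves the sup norm and unit steps, so one stored block serves every direction of
  entry.\<close>

fun in_frame :: "lattice \<Rightarrow> lattice \<Rightarrow> lattice \<Rightarrow> lattice" where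
  "in_frame d e (x, y, z) = lsmul x d + lsmul y e + lsmul z (lcross d e)"

text \<open>A straight block still needs a second frame vector; the cyclic shift is a uniform choice
  of a perpendicular axis.\<close>

fun rotl :: "lattice \<Rightarrow> lattice" where
  "rotl (x, y, z) = (z, x, y)"

lemma axes_cases:
  assumes "d \<in> axes"
  obtains "d = (1,0,0)" | "d = (-1,0,0)" | "d = (0,1,0)" | "d = (0,-1,0)" | "d = (0,0,1)" | "d = (0,0,-1)"
  using assms unfolding axes_def by blast

lemma rotl_axes: "d \<in> axes \<Longrightarrow> rotl d \<in> axes \<and> ldot d (rotl d) = 0"
  by (auto simp: axes_def)

text \<open>A path that does not turn back either goes straight or makes a right angle, which is why
  two blocks suffice.\<close>

lemma axes_orthogonal_or_equal:
  assumes "d \<in> axes" "e \<in> axes" "d + e \<noteq> 0" "e \<noteq> d"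
  shows "ldot d e = 0"
  using assms by (auto simp: axes_def zero_prod_def)

lemma ldot_axes_self: "d \<in> axes \<Longrightarrow> ldot d d = 1"
  by (auto simp: axes_def)

lemma in_frame_diff: "in_frame d e (u - v) = in_frame d e u - in_frame d e v"
  by (cases u; cases v; cases d; cases e) (simp add: algebra_simps)

lemma in_frame:
  assumes "d \<in> axes" "e \<in> axes" "ldot d e = 0"
  shows "supn (in_frame d e v) = supn v"
    and "ldot (in_frame d e v) d = fst v"
    and "ldot (in_frame d e v) e = fst (snd v)"
    and "v \<in> axes \<Longrightarrow> in_frame d e v \<in> axes"
    and "in_frame d e v = 0 \<longleftrightarrow> v = 0"
proof -
  obtain x y z where v: "v = (x, y, z)" by (cases v)
  show supn: "supn (in_frame d e v) = supn v"
    using assms unfolding v by (elim axes_cases) (simp_all add: max.commute max.left_commute)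
  show "ldot (in_frame d e v) d = fst v"
    using assms unfolding v by (elim axes_cases) simp_all
  show "ldot (in_frame d e v) e = fst (snd v)"
    using assms unfolding v by (elim axes_cases) simp_all
  have "w = 0 \<longleftrightarrow> supn w = 0" for w
    by (cases w) (simp add: zero_prod_def max_def; linarith)
  then show "in_frame d e v = 0 \<longleftrightarrow> v = 0"
    using supn by simp
  show "v \<in> axes \<Longrightarrow> in_frame d e v \<in> axes"
    using assms unfolding v by (elim axes_cases) (simp_all add: axes_def)
qed

lemma ldot_axes_le_supn: "d \<in> axes \<Longrightarrow> \<bar>ldot v d\<bar> \<le> supn v"
  by (cases v) (auto simp: axes_def)

lemma ldot_le_supn: "d \<in> axes \<Longrightarrow> ldot v d \<le> supn v"
  using ldot_axes_le_supn[of d v] by simp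

lemma supn_add: "supn (u + v) \<le> supn u + supn v"
proof -
  obtain x y z x' y' z' where u: "u = (x, y, z)" and v: "v = (x', y', z')"
    by (cases u; cases v)
  have "\<bar>x\<bar> \<le> supn u" "\<bar>y\<bar> \<le> supn u" "\<bar>z\<bar> \<le> supn u"
    "\<bar>x'\<bar> \<le> supn v" "\<bar>y'\<bar> \<le> supn v" "\<bar>z'\<bar> \<le> supn v"
    unfolding u v by simp_all
  then have "\<bar>x + x'\<bar> \<le> supn u + supn v" "\<bar>y + y'\<bar> \<le> supn u + supn v"
    "\<bar>z + z'\<bar> \<le> supn u + supn v"
    by (metis abs_triangle_ineq add_mono order_trans)+
  moreover have "supn (u + v) = max \<bar>x + x'\<bar> (max \<bar>y + y'\<bar> \<bar>z + z'\<bar>)"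
    unfolding u v by simp
  ultimately show ?thesis by simp
qed

lemma supn_diff: "supn u - supn v \<le> supn (u - v)"
  using supn_add[of "u - v" v] by simp

lemma supn_minus: "supn (- u) = supn u"
  by (cases u) auto

lemma supn_lsmul: "supn (lsmul k u) = \<bar>k\<bar> * supn u"
  by (cases u) (auto simp: abs_mult max_mult_distrib_left)

lemma ldot_add: "ldot (u + v) w = ldot u w + ldot v w"
  by (cases u; cases v; cases w) (simp add: algebra_simps)

lemma ldot_diff: "ldot (u - v) w = ldot u w - ldot v w"
  by (cases u; cases v; cases w) (simp add: algebra_simps)

lemma ldot_lsmul: "ldot (lsmul k u) w = k * ldot u w"
  by (cases u; cases w) (simp add: algebra_simps)

lemma ldot_commute: "ldot u w = ldot w u"
  by (cases u; cases w) (simp add: algebra_simps)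

lemma lsmul_diff: "lsmul k (u - v) = lsmul k u - lsmul k v"
  by (cases u; cases v) (simp add: algebra_simps)

section \<open>Two tubes of 49 cubes\<close>

text \<open>
  A block lists the centres of 49 unit cubes forming a tube inside a cube of side 7, in the coordinates
  of a frame whose first vector is the direction of entry. The tube leaves in the same direction
  (straight block) or in the direction of the second frame vector (turning block). Only its first and
  last cubes touch the faces of entry and exit, so that tubes in consecutive cubes do not interfere.
  Both blocks were found by a computer search.
\<close>

definition straight_block :: "lattice list" where
  "straight_block =
  [(-3,0,0), (-2,0,0), (-1,0,0), (-1,0,-1), (-1,0,-2), (-1,0,-3), (0,0,-3), (1,0,-3), 
   (1,1,-3), (1,2,-3), (1,3,-3), (0,3,-3), (-1,3,-3), (-1,3,-2), (-1,3,-1), (-1,3,0), 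
   (-1,3,1), (-1,3,2), (-1,2,2), (-1,1,2), (-1,0,2), (-1,-1,2), (-1,-2,2), (-1,-3,2), 
   (-1,-3,1), (-1,-3,0), (-1,-3,-1), (-1,-3,-2), (-1,-3,-3), (0,-3,-3), (1,-3,-3), 
   (2,-3,-3), (2,-3,-2), (2,-3,-1), (2,-2,-1), (2,-2,0), (2,-2,1), (2,-2,2), (2,-1,2), 
   (2,0,2), (2,1,2), (2,2,2), (2,3,2), (2,3,1), (2,3,0), (2,2,0), (2,1,0), (2,0,0), (3,0,0)]"

definition turning_block :: "lattice list" where
  "turning_block =
  [(-3,0,0), (-2,0,0), (-1,0,0), (-1,0,-1), (-1,0,-2), (-1,-1,-2), (-1,-2,-2), (-1,-2,-1), 
   (-1,-2,0), (0,-2,0), (1,-2,0), (2,-2,0), (3,-2,0), (3,-1,0), (3,0,0), (2,0,0), (1,0,0), 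
   (1,0,-1), (1,0,-2), (1,0,-3), (1,-1,-3), (1,-2,-3), (1,-3,-3), (2,-3,-3), (3,-3,-3), 
   (3,-2,-3), (3,-1,-3), (3,-1,-2), (3,0,-2), (3,1,-2), (3,2,-2), (2,2,-2), (1,2,-2), 
   (1,2,-3), (0,2,-3), (-1,2,-3), (-2,2,-3), (-2,2,-2), (-2,2,-1), (-2,2,0), (-2,2,1), 
   (-2,2,2), (-2,2,3), (-1,2,3), (0,2,3), (0,2,2), (0,2,1), (0,2,0), (0,3,0)]"

text \<open>When the path turns, cubes two steps apart share an edge, so these are only asked to be
  distinct. From three steps on, sup distance 2 between the centres leaves a gap of one unit between
  the cubes. The recursion lets rewriting check a concrete list.\<close>

fun spread :: "lattice list \<Rightarrow> bool" where
  "spread (a # b # c # xs) \<longleftrightarrow> a \<noteq> c \<and> (\<forall>q\<in>set xs. 2 \<le> supn (q - a)) \<and> spread (b # c # xs)"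
| "spread _ \<longleftrightarrow> True"

lemma spread_nth:
  assumes "spread xs" "i + 3 \<le> j" "j < length xs"
  shows "2 \<le> supn (xs ! j - xs ! i)"
  using assms
proof (induction xs arbitrary: i j rule: spread.induct)
  case (1 a b c xs)
  show ?case
  proof (cases i)
    case 0
    with 1 have "(a # b # c # xs) ! j = xs ! (j - 3)" "j - 3 < length xs"
      by (auto simp: nth_Cons' numeral_eq_Suc)
    with 1 0 show ?thesis by auto
  next
    case (Suc i')
    then obtain j' where "j = Suc j'" using 1(3) by (cases j) auto
    with 1 Suc show ?thesis by simp
  qed
qed auto

lemma spread_nth_Suc_Suc:
  assumes "spread xs" "Suc (Suc i) < length xs"
  shows "xs ! Suc (Suc i) \<noteq> xs ! i"
  using assms
proof (induction xs arbitrary: i rule: spread.induct)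
  case (1 a b c xs)
  show ?case by (cases i) (use 1 in auto)
qed auto

text \<open>The last condition keeps every cube but the first out of the layer at the face of entry.
  The exit face differs between the two blocks and is handled by separate facts.\<close>

definition good_block :: "lattice list \<Rightarrow> bool" where
  "good_block xs \<longleftrightarrow> length xs = 49 \<and> hd xs = (-3, 0, 0) \<and> spread xs \<and>
     successively (\<lambda>u v. v - u \<in> axes) xs \<and> list_all (\<lambda>v. supn v \<le> 3) xs \<and>
     list_all (\<lambda>v. - 2 \<le> fst v) (tl xs)"

lemma spread_straight: "spread straight_block"
  unfolding straight_block_def by (simp, simp add: zero_prod_def)

lemma spread_turning: "spread turning_block"
  unfolding turning_block_def by (simp, simp add: zero_prod_def)

lemma steps_straight: "successively (\<lambda>u v. v - u \<in> axes) straight_block"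
  unfolding straight_block_def by (simp, simp add: axes_def zero_prod_def)

lemma steps_turning: "successively (\<lambda>u v. v - u \<in> axes) turning_block"
  unfolding turning_block_def by (simp, simp add: axes_def zero_prod_def)

lemma good_straight: "good_block straight_block"
  unfolding good_block_def using spread_straight steps_straight
  by (simp add: straight_block_def)

lemma good_turning: "good_block turning_block"
  unfolding good_block_def using spread_turning steps_turning
  by (simp add: turning_block_def)

lemma exit_straight: "last straight_block = (3, 0, 0)"
  "list_all (\<lambda>v. fst v \<le> 2) (butlast straight_block)"
  by (simp_all add: straight_block_def)

lemma exit_turning: "last turning_block = (0, 3, 0)"
  "list_all (\<lambda>v. fst (snd v) \<le> 2) (butlast turning_block)"
  by (simp_all add: turning_block_def)

lemma good_block_nth:
  assumes "good_block xs"
  shows "xs ! 0 = (-3, 0, 0)"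
    and "j < 48 \<Longrightarrow> xs ! Suc j - xs ! j \<in> axes"
    and "j < 49 \<Longrightarrow> supn (xs ! j) \<le> 3"
    and "0 < j \<Longrightarrow> j < 49 \<Longrightarrow> - 2 \<le> fst (xs ! j)"
    and "j + 2 < 49 \<Longrightarrow> xs ! (j + 2) \<noteq> xs ! j"
    and "i + 3 \<le> j \<Longrightarrow> j < 49 \<Longrightarrow> 2 \<le> supn (xs ! j - xs ! i)"
proof -
  have len: "length xs = 49" and sp: "spread xs" using assms by (auto simp: good_block_def)
  show "xs ! 0 = (-3, 0, 0)" using assms len by (cases xs) (auto simp: good_block_def)
  show "j < 48 \<Longrightarrow> xs ! Suc j - xs ! j \<in> axes"
    using assms len by (simp add: good_block_def successively_conv_nth)
  show "j < 49 \<Longrightarrow> supn (xs ! j) \<le> 3"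
    using assms len by (simp add: good_block_def list_all_length)
  show "- 2 \<le> fst (xs ! j)" if "0 < j" "j < 49"
  proof -
    have "- 2 \<le> fst (tl xs ! (j - 1))"
      using assms len that by (simp add: good_block_def list_all_length)
    then show ?thesis using that len by (simp add: nth_tl)
  qed
  show "j + 2 < 49 \<Longrightarrow> xs ! (j + 2) \<noteq> xs ! j"
    using spread_nth_Suc_Suc[OF sp, of j] len by simp
  show "i + 3 \<le> j \<Longrightarrow> j < 49 \<Longrightarrow> 2 \<le> supn (xs ! j - xs ! i)"
    using spread_nth[OF sp] len by simp
qed

definition block_offset :: "lattice \<Rightarrow> lattice \<Rightarrow> nat \<Rightarrow> lattice" where
  "block_offset d e j =
     (if d = e then in_frame d (rotl d) (straight_block ! j) else in_frame d e (turning_block ! j))"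

text \<open>This hides which block is in use: afterwards only the frame, \<open>good_block\<close>
  and the behaviour at the exit face matter.\<close>

lemma block_offset_frame:
  assumes "d \<in> axes" "e \<in> axes" "d + e \<noteq> 0"
  obtains e' xs where "e' \<in> axes" "ldot d e' = 0" "good_block xs"
    "\<And>j. block_offset d e j = in_frame d e' (xs ! j)"
    "in_frame d e' (xs ! 48) = lsmul 3 e"
    "\<And>j. j < 48 \<Longrightarrow> ldot (in_frame d e' (xs ! j)) e \<le> 2"
proof (cases "d = e")
  case True
  have r: "rotl d \<in> axes" "ldot d (rotl d) = 0" using rotl_axes assms by auto
  have len: "length straight_block = 49" using good_straight by (simp add: good_block_def)
  then have ne: "straight_block \<noteq> []" by auto
  have last: "straight_block ! 48 = (3, 0, 0)"
    using exit_straight(1) len ne by (simp add: last_conv_nth)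
  show ?thesis
  proof
    show "rotl d \<in> axes" "ldot d (rotl d) = 0" "good_block straight_block"
      using r good_straight by auto
    show "block_offset d e j = in_frame d (rotl d) (straight_block ! j)" for j
      using True by (simp add: block_offset_def)
    show "in_frame d (rotl d) (straight_block ! 48) = lsmul 3 e"
      unfolding last True[symmetric] by (cases d) (simp add: zero_prod_def)
    show "ldot (in_frame d (rotl d) (straight_block ! j)) e \<le> 2" if "j < 48" for j
    proof -
      have "fst (straight_block ! j) \<le> 2"
        using exit_straight(2) that len by (simp add: list_all_length nth_butlast)
      then show ?thesis using in_frame(2)[OF assms(1) r] True by simp
    qed
  qed
next
  case False
  have r: "ldot d e = 0" using axes_orthogonal_or_equal[OF assms] False by auto
  have len: "length turning_block = 49" using good_turning by (simp add: good_block_def)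
  then have ne: "turning_block \<noteq> []" by auto
  have last: "turning_block ! 48 = (0, 3, 0)"
    using exit_turning(1) len ne by (simp add: last_conv_nth)
  show ?thesis
  proof
    show "e \<in> axes" "ldot d e = 0" "good_block turning_block"
      using r good_turning assms by auto
    show "block_offset d e j = in_frame d e (turning_block ! j)" for j
      using False by (simp add: block_offset_def)
    show "in_frame d e (turning_block ! 48) = lsmul 3 e"
      unfolding last by (cases d; cases e) (simp add: zero_prod_def)
    show "ldot (in_frame d e (turning_block ! j)) e \<le> 2" if "j < 48" for j
    proof -
      have "fst (snd (turning_block ! j)) \<le> 2"
        using exit_turning(2) that len by (simp add: list_all_length nth_butlast)
      then show ?thesis using in_frame(3)[OF assms(1,2) r] by simp
    qed
  qed
qed

lemma block_offset:
  assumes "d \<in> axes" "e \<in> axes" "d + e \<noteq> 0"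
  shows "block_offset d e 0 = lsmul (- 3) d"
    and "block_offset d e 48 = lsmul 3 e"
    and "j < 48 \<Longrightarrow> block_offset d e (Suc j) - block_offset d e j \<in> axes"
    and "j < 49 \<Longrightarrow> supn (block_offset d e j) \<le> 3"
    and "0 < j \<Longrightarrow> j < 49 \<Longrightarrow> - 2 \<le> ldot (block_offset d e j) d"
    and "j < 48 \<Longrightarrow> ldot (block_offset d e j) e \<le> 2"
    and "j + 2 < 49 \<Longrightarrow> block_offset d e (j + 2) \<noteq> block_offset d e j"
    and "i + 3 \<le> j \<Longrightarrow> j < 49 \<Longrightarrow> 2 \<le> supn (block_offset d e j - block_offset d e i)"
proof -
  obtain e' xs where f: "e' \<in> axes" "ldot d e' = 0" and g: "good_block xs"
    and b: "\<And>j. block_offset d e j = in_frame d e' (xs ! j)"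
    and l: "in_frame d e' (xs ! 48) = lsmul 3 e"
    and u: "\<And>j. j < 48 \<Longrightarrow> ldot (in_frame d e' (xs ! j)) e \<le> 2"
    using block_offset_frame[OF assms] by metis
  note F = in_frame[OF assms(1) f] and G = good_block_nth[OF g]
  show "block_offset d e 0 = lsmul (- 3) d" unfolding b G(1) by (cases d; cases e') simp
  show "block_offset d e 48 = lsmul 3 e" using b l by simp
  show "j < 48 \<Longrightarrow> block_offset d e (Suc j) - block_offset d e j \<in> axes"
    unfolding b in_frame_diff[symmetric] by (intro F G)
  show "j < 49 \<Longrightarrow> supn (block_offset d e j) \<le> 3" unfolding b F by (rule G)
  show "0 < j \<Longrightarrow> j < 49 \<Longrightarrow> - 2 \<le> ldot (block_offset d e j) d" unfolding b F by (rule G)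
  show "j < 48 \<Longrightarrow> ldot (block_offset d e j) e \<le> 2" using b u by simp
  show "block_offset d e (j + 2) \<noteq> block_offset d e j" if "j + 2 < 49"
  proof -
    have "in_frame d e' (xs ! (j + 2) - xs ! j) \<noteq> 0" using F(5) G(5)[OF that] by simp
    then show ?thesis unfolding b in_frame_diff by simp
  qed
  show "i + 3 \<le> j \<Longrightarrow> j < 49 \<Longrightarrow> 2 \<le> supn (block_offset d e j - block_offset d e i)"
    unfolding b in_frame_diff[symmetric] F by (rule G)
qed

section \<open>Refinement of lattice arcs\<close>

definition lattice_arc :: "(int \<Rightarrow> lattice) \<Rightarrow> bool" where
  "lattice_arc p \<longleftrightarrow> (\<forall>i. p (i + 1) - p i \<in> axes) \<and> (\<forall>i. p (i + 2) \<noteq> p i) \<and>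
     (\<forall>i j. i + 3 \<le> j \<longrightarrow> 2 \<le> supn (p j - p i))"

text \<open>Cube \<open>i\<close> is blown up to side 7 and replaced by its block, whose cubes
  receive the indices \<open>49 * i + a\<close>. A factor 49 in time against a factor 7 in space is
  the exponent 1/2. The index set is all of the integers, so every cube has a step into it and a
  step out of it.\<close>

definition refine :: "(int \<Rightarrow> lattice) \<Rightarrow> int \<Rightarrow> lattice" where
  "refine p n = (let i = n div 49 in
     lsmul 7 (p i) + block_offset (p i - p (i - 1)) (p (i + 1) - p i) (nat (n mod 49)))"

lemma lattice_arc_directions:
  assumes "lattice_arc p"
  shows "p i - p (i - 1) \<in> axes" "p (i + 1) - p i \<in> axes"
    "(p i - p (i - 1)) + (p (i + 1) - p i) \<noteq> 0"
proof -
  show "p i - p (i - 1) \<in> axes" "p (i + 1) - p i \<in> axes"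
    using assms unfolding lattice_arc_def by (metis diff_add_cancel)+
  have "p (i - 1 + 2) \<noteq> p (i - 1)"
    using assms unfolding lattice_arc_def by blast
  moreover have "i - 1 + 2 = i + 1" by simp
  ultimately have "p (i + 1) \<noteq> p (i - 1)" by metis
  then show "(p i - p (i - 1)) + (p (i + 1) - p i) \<noteq> 0" by simp
qed

lemma refine_at:
  assumes "a < 49"
  shows "refine p (49 * i + int a) =
    lsmul 7 (p i) + block_offset (p i - p (i - 1)) (p (i + 1) - p i) a"
  using assms by (simp add: refine_def Let_def)

lemma refine_near:
  assumes "lattice_arc p"
  shows "supn (refine p n - lsmul 7 (p (n div 49))) \<le> 3"
proof -
  have "nat (n mod 49) < 49" by (simp add: nat_less_iff)
  then show ?thesis
    unfolding refine_def Let_def using block_offset(4)[OF lattice_arc_directions[OF assms]] by simp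
qed

text \<open>Along the step from one large cube to the next the centres are 7 apart. Each offset uses
  up at most 3, and 3 is possible only for the exit cube of the first block and the entry cube of
  the second. Without that pair at least \<open>7 - 3 - 2\<close> remains.\<close>

lemma refine_consecutive_blocks:
  assumes p: "lattice_arc p" and ab: "a < 49" "b < 49" "a \<noteq> 48 \<or> b \<noteq> 0"
  shows "2 \<le> ldot (refine p (49 * (i + 1) + int b) - refine p (49 * i + int a)) (p (i + 1) - p i)"
proof -
  define d where "d = p (i + 1) - p i"
  note D = lattice_arc_directions[OF p, of i] lattice_arc_directions[OF p, of "i + 1"]
  have d: "d \<in> axes" using D d_def by simp
  note O1 = block_offset[OF D(1,2,3)] and O2 = block_offset[OF D(4,5,6)]
  define u where "u = block_offset (p i - p (i - 1)) (p (i + 1) - p i) a"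
  define v where "v = block_offset (p (i + 1) - p (i + 1 - 1)) (p (i + 1 + 1) - p (i + 1)) b"
  have u: "ldot u d \<le> 3" "a < 48 \<Longrightarrow> ldot u d \<le> 2"
    using ldot_axes_le_supn[OF d, of u] O1(4)[OF ab(1)] O1(6)[of a] unfolding u_def d_def by auto
  have v: "- 3 \<le> ldot v d" "b > 0 \<Longrightarrow> - 2 \<le> ldot v d"
    using ldot_axes_le_supn[OF d, of v] O2(4)[OF ab(2)] O2(5)[of b] ab unfolding v_def d_def by auto
  have "refine p (49 * (i + 1) + int b) - refine p (49 * i + int a) = lsmul 7 d + (v - u)"
    unfolding refine_at[OF ab(1)] refine_at[OF ab(2)] u_def v_def d_def lsmul_diff by simp
  then have "ldot (refine p (49 * (i + 1) + int b) - refine p (49 * i + int a)) d =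
      7 + (ldot v d - ldot u d)"
    using d by (simp add: ldot_add ldot_diff ldot_lsmul ldot_axes_self)
  then show ?thesis using u v ab unfolding d_def[symmetric] by (cases "a = 48") auto
qed

text \<open>A cube other than the exit cube leaves \<open>7 - 2 - 3\<close> along the first step
  \<open>d\<close>. The exit cube sits exactly at \<open>3 d\<close>: if the path goes straight on,
  \<open>14 - 6\<close> remains along \<open>d\<close>; if it turns, the exit cube has offset 0
  along the second step \<open>e\<close>, where \<open>7 - 3\<close> remains.\<close>

lemma refine_blocks_at_distance_two:
  assumes p: "lattice_arc p" and ab: "a < 49" "b < 49"
  shows "2 \<le> supn (refine p (49 * (i + 2) + int b) - refine p (49 * i + int a))"
proof -
  define d where "d = p (i + 1) - p i"
  define e where "e = p (i + 2) - p (i + 1)"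
  have i2: "i + 1 + 1 = i + 2" "i + 2 - 1 = i + 1" by auto
  note D = lattice_arc_directions[OF p, of i] lattice_arc_directions[OF p, of "i + 2"]
    lattice_arc_directions[OF p, of "i + 1"]
  have d: "d \<in> axes" and e: "e \<in> axes" using D d_def e_def i2 by metis+
  have de0: "d + e \<noteq> 0"
    using D(9) unfolding i2 d_def e_def by simp
  have de: "0 \<le> ldot e d"
    using axes_orthogonal_or_equal[OF d e de0] ldot_axes_self[OF d] ldot_commute[of e d] by fastforce
  note O1 = block_offset[OF D(1,2,3)] and O2 = block_offset[OF D(4,5,6)]
  define u where "u = block_offset (p i - p (i - 1)) (p (i + 1) - p i) a"
  define v where "v = block_offset (p (i + 2) - p (i + 2 - 1)) (p (i + 2 + 1) - p (i + 2)) b"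
  define w where "w = refine p (49 * (i + 2) + int b) - refine p (49 * i + int a)"
  have w: "w = lsmul 7 d + lsmul 7 e + (v - u)"
    unfolding refine_at[OF ab(1)] refine_at[OF ab(2)] u_def v_def d_def e_def w_def lsmul_diff by simp
  have sv: "supn v \<le> 3" using O2(4)[OF ab(2)] by (simp add: v_def)
  have su: "supn u \<le> 3" using O1(4)[OF ab(1)] by (simp add: u_def)
  have wd: "ldot w d = 7 + 7 * ldot e d + (ldot v d - ldot u d)"
    unfolding w using d by (simp add: ldot_add ldot_diff ldot_lsmul ldot_axes_self)
  have vd: "- 3 \<le> ldot v d" "ldot u d \<le> 3"
    using ldot_axes_le_supn[OF d, of v] sv ldot_axes_le_supn[OF d, of u] su by auto
  show ?thesis
  proof (cases "a < 48")
    case True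
    then have "ldot u d \<le> 2" using O1(6)[of a] unfolding u_def d_def by simp
    then have "2 \<le> ldot w d" using wd vd de by simp
    then show ?thesis using ldot_le_supn[OF d, of w] unfolding w_def by simp
  next
    case False
    then have a: "a = 48" using ab by simp
    have u: "u = lsmul 3 d" unfolding u_def a d_def by (rule O1)
    show ?thesis
    proof (cases "e = d")
      case True
      then have "2 \<le> ldot w d" using wd vd ldot_axes_self[OF d] by simp
      then show ?thesis using ldot_le_supn[OF d, of w] unfolding w_def by simp
    next
      case False
      then have o: "ldot d e = 0" using axes_orthogonal_or_equal[OF d e de0] by simp
      have "ldot w e = 7 + ldot v e"
        unfolding w u using e o by (simp add: ldot_add ldot_diff ldot_lsmul ldot_axes_self)
      moreover have "- 3 \<le> ldot v e" using ldot_axes_le_supn[OF e, of v] sv by auto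
      ultimately have "2 \<le> ldot w e" by simp
      then show ?thesis using ldot_le_supn[OF e, of w] unfolding w_def by simp
    qed
  qed
qed

lemma block_index:
  fixes n :: int
  obtains i a where "n = 49 * i + int a" "a < 49"
proof
  show "n = 49 * (n div 49) + int (nat (n mod 49))" by simp
  show "nat (n mod 49) < 49" by (simp add: nat_less_iff)
qed

lemma lattice_arc_refine:
  assumes p: "lattice_arc p"
  shows "lattice_arc (refine p)"
  unfolding lattice_arc_def
proof (intro conjI allI impI)
  note D = lattice_arc_directions[OF p]
  note O = block_offset[OF D]
  fix n :: int
  obtain i a where n: "n = 49 * i + int a" and a: "a < 49" by (rule block_index)
  show "refine p (n + 1) - refine p n \<in> axes"
  proof (cases "a < 48")
    case True
    have "n + 1 = 49 * i + int (Suc a)" using n by simp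
    then have "refine p (n + 1) - refine p n =
        block_offset (p i - p (i - 1)) (p (i + 1) - p i) (Suc a) -
        block_offset (p i - p (i - 1)) (p (i + 1) - p i) a"
      using True a n by (simp only: refine_at) simp
    then show ?thesis using O(3)[OF True] by simp
  next
    case False
    then have a': "a = 48" using a by simp
    \<comment> \<open>The exit cube is at 3 and the next entry cube at \<open>7 - 3 = 4\<close>
      along the same direction, one unit step apart.\<close>
    have n1: "n + 1 = 49 * (i + 1) + int 0" using n a' by simp
    have "refine p (n + 1) - refine p n =
        lsmul 7 (p (i + 1)) + lsmul (- 3) (p (i + 1) - p i) - (lsmul 7 (p i) + lsmul 3 (p (i + 1) - p i))"
      unfolding n1 unfolding n a' using O(1)[of "i + 1"] O(2)[of i] by (simp only: refine_at) simp
    also have "\<dots> = p (i + 1) - p i" by (cases "p (i + 1)"; cases "p i") simp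
    finally show ?thesis using D by simp
  qed
  show "refine p (n + 2) \<noteq> refine p n"
  proof (cases "a + 2 < 49")
    case True
    have "n + 2 = 49 * i + int (a + 2)" using n by simp
    then have "refine p (n + 2) - refine p n =
        block_offset (p i - p (i - 1)) (p (i + 1) - p i) (a + 2) -
        block_offset (p i - p (i - 1)) (p (i + 1) - p i) a"
      using True a n by (simp only: refine_at) simp
    then show ?thesis using O(7)[OF True, of i] by auto
  next
    case False
    \<comment> \<open>Here \<open>a\<close> is 47 or 48, so the target is cube 0 or 1 of the next
      block, and the touching pair of exit and entry cube does not occur.\<close>
    define b where "b = a - 47"
    have b: "n + 2 = 49 * (i + 1) + int b" "b < 49" "a \<noteq> 48 \<or> b \<noteq> 0"
      using False a n unfolding b_def by auto
    have "2 \<le> ldot (refine p (n + 2) - refine p n) (p (i + 1) - p i)"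
      using refine_consecutive_blocks[OF p a b(2,3), of i] unfolding b(1) unfolding n by simp
    then show ?thesis by (cases "p (i + 1) - p i") (auto simp: zero_prod_def)
  qed
  fix m :: int assume nm: "n + 3 \<le> m"
  obtain j b where m: "m = 49 * j + int b" and b: "b < 49" by (rule block_index)
  have "i \<le> j" using n m nm a b by linarith
  then consider "j = i" | "j = i + 1" | "j = i + 2" | "i + 3 \<le> j" by linarith
  then show "2 \<le> supn (refine p m - refine p n)"
  proof cases
    case 1
    then have ab: "a + 3 \<le> b" using n m nm by simp
    have "refine p m - refine p n =
        block_offset (p i - p (i - 1)) (p (i + 1) - p i) b -
        block_offset (p i - p (i - 1)) (p (i + 1) - p i) a"
      unfolding n m using 1 a b by (simp only: refine_at) simp
    then show ?thesis using O(8)[OF ab b] by simp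
  next
    case 2
    have "a \<noteq> 48 \<or> b \<noteq> 0" using 2 n m nm by auto
    from refine_consecutive_blocks[OF p a b this, of i] ldot_le_supn[OF D(2)]
    show ?thesis unfolding n m 2 by (meson order_trans)
  next
    case 3
    then show ?thesis using refine_blocks_at_distance_two[OF p a b] unfolding n m by simp
  next
    case 4
    \<comment> \<open>For blocks at least three apart the invariant of \<open>p\<close> alone
      suffices: the centres are at least 14 apart and the two offsets cost at most 6.\<close>
    define w where "w = lsmul 7 (p j - p i)"
    define u where "u = refine p m - lsmul 7 (p j)"
    define v where "v = refine p n - lsmul 7 (p i)"
    have "m div 49 = j" "n div 49 = i" unfolding m n using a b by auto
    then have uv: "supn u \<le> 3" "supn v \<le> 3"
      using refine_near[OF p, of m] refine_near[OF p, of n] unfolding u_def v_def by auto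
    have "2 \<le> supn (p j - p i)" using p 4 unfolding lattice_arc_def by blast
    then have "14 \<le> supn w" unfolding w_def supn_lsmul by simp
    moreover have "refine p m - refine p n = w - (v - u)"
      unfolding w_def u_def v_def lsmul_diff by simp
    moreover have "supn (v - u) \<le> supn v + supn u"
      using supn_add[of v "- u"] supn_minus[of u] by simp
    ultimately show ?thesis using supn_diff[of w "v - u"] uv by simp
  qed
qed

text \<open>An index of level \<open>k\<close> stands for a time interval of length
  \<open>1 / 49 ^ k\<close>, a lattice point for a cube of side \<open>1 / 7 ^ k\<close>.\<close>

primrec koch_path :: "nat \<Rightarrow> int \<Rightarrow> lattice" where
  "koch_path 0 = (\<lambda>n. (n, 0, 0))"
| "koch_path (Suc k) = refine (koch_path k)"

lemma lattice_arc_koch_path: "lattice_arc (koch_path k)"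
proof (induction k)
  case 0
  show ?case by (auto simp: lattice_arc_def axes_def zero_prod_def)
qed (simp add: lattice_arc_refine)

section \<open>The limit curve and its snowflake bounds\<close>

definition lattice_point :: "lattice \<Rightarrow> real^3" where
  "lattice_point v = (case v of (x, y, z) \<Rightarrow> vector [of_int x, of_int y, of_int z])"

lemma lattice_point_diff: "lattice_point (u - v) = lattice_point u - lattice_point v"
  by (cases u; cases v) (simp add: lattice_point_def vec_eq_iff forall_3)

lemma lattice_point_lsmul: "lattice_point (lsmul k u) = of_int k *\<^sub>R lattice_point u"
  by (cases u) (simp add: lattice_point_def vec_eq_iff forall_3)

lemma lattice_point_le_supn: "\<bar>lattice_point v $ m\<bar> \<le> of_int (supn v)"
proof (cases v)
  case (fields x y z)
  have "\<bar>x\<bar> \<le> supn v" "\<bar>y\<bar> \<le> supn v" "\<bar>z\<bar> \<le> supn v"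
    unfolding fields by auto
  then have "\<bar>lattice_point v $ 1\<bar> \<le> of_int (supn v) \<and> \<bar>lattice_point v $ 2\<bar> \<le> of_int (supn v) \<and>
    \<bar>lattice_point v $ 3\<bar> \<le> of_int (supn v)"
    unfolding fields lattice_point_def by (simp flip: of_int_abs del: supn.simps)
  then show ?thesis using exhaust_3[of m] by metis
qed

lemma supn_attained: "\<exists>m. \<bar>lattice_point v $ m\<bar> = of_int (supn v)"
proof (cases v)
  case (fields x y z)
  have "supn v = \<bar>x\<bar> \<or> supn v = \<bar>y\<bar> \<or> supn v = \<bar>z\<bar>"
    unfolding fields by (auto simp: max_def)
  moreover have "\<bar>lattice_point v $ 1\<bar> = of_int \<bar>x\<bar>" "\<bar>lattice_point v $ 2\<bar> = of_int \<bar>y\<bar>"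
    "\<bar>lattice_point v $ 3\<bar> = of_int \<bar>z\<bar>"
    unfolding fields lattice_point_def by simp_all
  ultimately show ?thesis by metis
qed

text \<open>The radius is the tail of the series: the increments from level \<open>k\<close> on sum
  to \<open>1 / 2 / 7 ^ k\<close>. With this radius the intervals from \<open>f k\<close> to
  \<open>g k\<close> are nested and shrink to a point.\<close>

lemma geometric_approximation_limit:
  fixes a :: "nat \<Rightarrow> real"
  assumes "\<And>k. \<bar>a (Suc k) - a k\<bar> \<le> 3 / 7 ^ Suc k"
  obtains l where "\<And>k. \<bar>l - a k\<bar> \<le> 1 / 2 / 7 ^ k"
proof -
  define f g where "f k = a k - 1 / 2 / 7 ^ k" and "g k = a k + 1 / 2 / 7 ^ k" for k
  have step: "1 / 2 / 7 ^ k - 1 / 2 / 7 ^ Suc k = (3 / 7 ^ Suc k :: real)" for k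
    by (simp add: field_simps)
  have "f k \<le> f (Suc k)" "g (Suc k) \<le> g k" "f k \<le> g k" for k
    using assms[of k] step[of k] unfolding f_def g_def abs_le_iff by auto
  moreover have "(\<lambda>k. f k - g k) \<longlonglongrightarrow> 0"
  proof -
    have "(\<lambda>k. - ((1 / 7 :: real) ^ k)) \<longlonglongrightarrow> - 0"
      by (intro tendsto_minus LIMSEQ_realpow_zero) auto
    moreover have "f k - g k = - ((1 / 7 :: real) ^ k)" for k
      unfolding f_def g_def by (simp add: power_divide)
    ultimately show ?thesis by simp
  qed
  ultimately obtain l where "\<And>k. f k \<le> l" "\<And>k. l \<le> g k"
    using nested_sequence_unique[of f g] by blast
  then have "\<bar>l - a k\<bar> \<le> 1 / 2 / 7 ^ k" for k
    unfolding f_def g_def abs_le_iff by (smt (verit))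
  then show ?thesis using that by blast
qed

text \<open>The index of a time at one level has its index at the previous level as parent, so
  successive approximations of \<open>K t\<close> differ by a single block offset.\<close>

lemma floor_refine: "\<lfloor>49 ^ Suc k * t\<rfloor> div 49 = \<lfloor>49 ^ k * t :: real\<rfloor>"
proof -
  have "\<lfloor>49 ^ Suc k * t / real_of_int 49\<rfloor> = \<lfloor>49 ^ Suc k * t\<rfloor> div 49"
    by (rule floor_divide_real_eq_div) simp
  then show ?thesis by simp
qed

text \<open>\<open>K t\<close> is the common point of the nested closed cubes of side
  \<open>1 / 7 ^ k\<close> that the paths assign to the time \<open>t\<close>. The bounds below rest
  on this estimate alone.\<close>

lemma koch_curve_exists:
  obtains K :: "real \<Rightarrow> real^3"
    where "\<And>t k m. \<bar>K t $ m - lattice_point (koch_path k \<lfloor>49 ^ k * t\<rfloor>) $ m / 7 ^ k\<bar> \<le> 1 / 2 / 7 ^ k"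
proof -
  have "\<exists>l. \<forall>k. \<bar>l - lattice_point (koch_path k \<lfloor>49 ^ k * t\<rfloor>) $ m / 7 ^ k\<bar> \<le> 1 / 2 / 7 ^ k" for t :: real and m
  proof -
    define a where "a k = lattice_point (koch_path k \<lfloor>49 ^ k * t\<rfloor>) $ m / 7 ^ k" for k
    have "\<bar>a (Suc k) - a k\<bar> \<le> 3 / 7 ^ Suc k" for k
    proof -
      define v where "v = koch_path (Suc k) \<lfloor>49 ^ Suc k * t\<rfloor> - lsmul 7 (koch_path k \<lfloor>49 ^ k * t\<rfloor>)"
      have "supn v \<le> 3"
        using refine_near[OF lattice_arc_koch_path, of k "\<lfloor>49 ^ Suc k * t\<rfloor>"]
        unfolding floor_refine v_def by (simp del: power_Suc)
      then have "\<bar>lattice_point v $ m\<bar> \<le> 3"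
        using lattice_point_le_supn[of v m] by linarith
      moreover have "a (Suc k) - a k = lattice_point v $ m / 7 ^ Suc k"
        unfolding a_def v_def lattice_point_diff lattice_point_lsmul by (simp add: field_simps)
      ultimately show ?thesis by (simp add: divide_right_mono del: power_Suc)
    qed
    then show ?thesis using geometric_approximation_limit[of a] unfolding a_def by metis
  qed
  then obtain l :: "real \<Rightarrow> 3 \<Rightarrow> real" where "\<And>t m k. \<bar>l t m - lattice_point (koch_path k \<lfloor>49 ^ k * t\<rfloor>) $ m / 7 ^ k\<bar> \<le> 1 / 2 / 7 ^ k"
    by metis
  then show ?thesis using that[of "\<lambda>t. \<chi> m. l t m"] by simp
qed

lemma snowflake_bounds_ordered:
  fixes K :: "real \<Rightarrow> real^3"
  assumes K: "\<And>t k m. \<bar>K t $ m - lattice_point (koch_path k \<lfloor>49 ^ k * t\<rfloor>) $ m / 7 ^ k\<bar> \<le> 1 / 2 / 7 ^ k"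
    and uv: "u < v" "v \<le> u + 1"
  shows "sqrt (v - u) / 13 \<le> dist (K u) (K v)" and "dist (K u) (K v) \<le> 42 * sqrt (v - u)"
proof -
  define w where "w k = koch_path k \<lfloor>49 ^ k * v\<rfloor> - koch_path k \<lfloor>49 ^ k * u\<rfloor>" for k
  have Kw: "\<bar>(K v $ m - K u $ m) - lattice_point (w k) $ m / 7 ^ k\<bar> \<le> 1 / 7 ^ k" for k m
    using K[of v m k] K[of u m k] unfolding w_def lattice_point_diff
    by (simp add: diff_divide_distrib)
  show "sqrt (v - u) / 13 \<le> dist (K u) (K v)"
  proof -
    define P where "P k \<longleftrightarrow> \<lfloor>49 ^ k * u\<rfloor> + 3 \<le> \<lfloor>49 ^ k * v\<rfloor>" for k
    have "\<exists>k. P k"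
    proof -
      obtain k where "4 / (v - u) < 49 ^ k"
        using real_arch_pow[of 49 "4 / (v - u)"] by auto
      then have "4 < 49 ^ k * v - 49 ^ k * u"
        using uv by (simp add: field_simps)
      then have "P k" unfolding P_def by linarith
      then show ?thesis ..
    qed
    \<comment> \<open>At the first level where the indices are three apart the cubes are separated.
      At the level before they are not, which bounds \<open>v - u\<close> from above by the same
      scale.\<close>
    define k where "k = (LEAST k. P k)"
    have "P k" unfolding k_def by (rule LeastI_ex) fact
    then have "2 \<le> supn (w k)"
      using lattice_arc_koch_path[of k] unfolding P_def lattice_arc_def w_def by blast
    then obtain m where "2 \<le> \<bar>lattice_point (w k) $ m\<bar>"
      using supn_attained[of "w k"] by (metis of_int_le_iff of_int_numeral)
    then have "2 / 7 ^ k \<le> \<bar>lattice_point (w k) $ m / 7 ^ k\<bar>"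
      by (simp add: divide_right_mono)
    then have "1 / 7 ^ k \<le> \<bar>K v $ m - K u $ m\<bar>" using Kw[of m k] by simp
    also have "\<dots> \<le> dist (K u) (K v)"
      using dist_vec_nth_le[of "K v" m "K u"] unfolding dist_real_def dist_commute[of "K u"] .
    finally have lower: "1 / 7 ^ k \<le> dist (K u) (K v)" .
    have "sqrt (v - u) \<le> 13 / 7 ^ k"
    proof (cases k)
      case 0
      have "sqrt (v - u) \<le> 1" using uv by simp
      also have "\<dots> \<le> 13 / 7 ^ k" using 0 by simp
      finally show ?thesis .
    next
      case (Suc j)
      have "\<not> P j" using Suc unfolding k_def by (metis not_less_Least lessI)
      then have "49 ^ j * v - 49 ^ j * u < 3" unfolding P_def by linarith
      \<comment> \<open>Fewer than 3 cells of length \<open>49 / 49 ^ k\<close> give 147, and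
        \<open>13\<^sup>2 = 169\<close> exceeds it.\<close>
      then have "v - u \<le> 147 / 49 ^ k" using Suc by (simp add: field_simps)
      also have "\<dots> \<le> (13 / 7 ^ k)\<^sup>2"
        by (simp add: power_divide divide_right_mono flip: power_mult_distrib power_mult)
          (simp add: divide_right_mono power_mult mult.commute[of k])
      finally show ?thesis by (simp add: real_le_lsqrt)
    qed
    then show ?thesis using lower by simp
  qed
  show "dist (K u) (K v) \<le> 42 * sqrt (v - u)"
  proof -
    have "\<exists>k. 1 < 49 ^ k * (v - u)"
      using real_arch_pow[of 49 "1 / (v - u)"] uv by (auto simp: field_simps)
    \<comment> \<open>This is the first level at which the time gap exceeds one cell; it is positive
      because the gap is at most 1. One level earlier the indices differ by at most 1, so each of
      the three coordinates differs by at most \<open>2 / 7 ^ k\<close>. Passing from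
      \<open>k\<close> back to \<open>n\<close> costs a factor 7, whence
      \<open>42 = 6 * 7\<close>.\<close>
    define n where "n = (LEAST k. 1 < 49 ^ k * (v - u))"
    have n: "1 < 49 ^ n * (v - u)" unfolding n_def by (rule LeastI_ex) fact
    then obtain k where k: "n = Suc k" using uv by (cases n) auto
    have "\<not> 1 < 49 ^ k * (v - u)" using k unfolding n_def by (metis not_less_Least lessI)
    then have "49 ^ k * v \<le> 49 ^ k * u + 1" by (simp add: algebra_simps)
    moreover have "49 ^ k * u \<le> 49 ^ k * v" using uv by simp
    ultimately have "\<lfloor>49 ^ k * v\<rfloor> = \<lfloor>49 ^ k * u\<rfloor> \<or> \<lfloor>49 ^ k * v\<rfloor> = \<lfloor>49 ^ k * u\<rfloor> + 1"
      by linarith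
    then have "w k = 0 \<or> w k \<in> axes"
      using lattice_arc_koch_path[of k] unfolding w_def lattice_arc_def by auto
    then have "supn (w k) \<le> 1" by (auto simp: axes_def zero_prod_def)
    then have "\<bar>lattice_point (w k) $ m\<bar> \<le> 1" for m
      using lattice_point_le_supn[of "w k" m] by linarith
    then have "\<bar>lattice_point (w k) $ m / 7 ^ k\<bar> \<le> 1 / 7 ^ k" for m
      by (simp add: divide_right_mono)
    then have comp: "\<bar>K v $ m - K u $ m\<bar> \<le> 2 / 7 ^ k" for m
    proof -
      have "2 / 7 ^ k = 1 / 7 ^ k + (1 / 7 ^ k :: real)" by simp
      then show ?thesis
        using Kw[of m k] \<open>\<bar>lattice_point (w k) $ m / 7 ^ k\<bar> \<le> 1 / 7 ^ k\<close> by linarith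
    qed
    have "dist (K u) (K v) \<le> (\<Sum>m\<in>UNIV. \<bar>(K v - K u) $ m\<bar>)"
      using norm_le_l1_cart[of "K v - K u"] by (simp add: dist_norm norm_minus_commute)
    also have "\<dots> \<le> 6 / 7 ^ k"
      using comp[of 1] comp[of 2] comp[of 3] by (simp add: sum_3)
    also have "\<dots> \<le> 42 * sqrt (v - u)"
    proof -
      have "(1 / 7 ^ n)\<^sup>2 = (1 / 49 ^ n :: real)"
        by (simp add: power_divide mult.commute[of n] flip: power_mult) (simp add: power_mult)
      also have "\<dots> \<le> v - u" using n by (simp add: field_simps)
      finally have "1 / 7 ^ n \<le> sqrt (v - u)" by (simp add: real_le_rsqrt)
      then show ?thesis unfolding k by simp
    qed
    finally show ?thesis .
  qed
qed

text \<open>The bound on \<open>\<bar>u - v\<bar>\<close> reflects that the refinements start from a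
  straight line at level 0: on large scales the constructed curve grows linearly.\<close>

definition snowflake_map :: "(real \<Rightarrow> real^3) \<Rightarrow> bool" where
  "snowflake_map K \<longleftrightarrow> (\<forall>u v. \<bar>u - v\<bar> \<le> 1 \<longrightarrow>
     sqrt \<bar>u - v\<bar> / 13 \<le> dist (K u) (K v) \<and> dist (K u) (K v) \<le> 42 * sqrt \<bar>u - v\<bar>)"

proposition snowflake_map_exists: "\<exists>K. snowflake_map K"
proof -
  obtain K :: "real \<Rightarrow> real^3"
    where K: "\<And>t k m. \<bar>K t $ m - lattice_point (koch_path k \<lfloor>49 ^ k * t\<rfloor>) $ m / 7 ^ k\<bar> \<le> 1 / 2 / 7 ^ k"
    by (rule koch_curve_exists) blast
  have "sqrt \<bar>u - v\<bar> / 13 \<le> dist (K u) (K v) \<and> dist (K u) (K v) \<le> 42 * sqrt \<bar>u - v\<bar>"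
    if "\<bar>u - v\<bar> \<le> 1" for u v
  proof -
    consider "u < v" | "u = v" | "v < u" by linarith
    then show ?thesis
      using snowflake_bounds_ordered[OF K, of u v] snowflake_bounds_ordered[OF K, of v u] that
      by cases (auto simp: dist_commute)
  qed
  then show ?thesis unfolding snowflake_map_def by blast
qed

section \<open>Leaves of the characteristic foliation\<close>

lemma real_derivative_bound:
  fixes f f' :: "real \<Rightarrow> real"
  assumes "\<And>x. x \<in> {a..b} \<Longrightarrow> (f has_real_derivative f' x) (at x within {a..b})"
    and "\<And>x. x \<in> {a..b} \<Longrightarrow> \<bar>f' x\<bar> \<le> B"
    and "x \<in> {a..b}" "y \<in> {a..b}"
  shows "\<bar>f x - f y\<bar> \<le> B * \<bar>x - y\<bar>"
  using field_differentiable_bound[of "{a..b}" f f' B x y] assms by simp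

text \<open>This replaces Gronwall's inequality on a short interval: if \<open>M\<close> is the
  maximal gap, the gap varies by at most \<open>2 * r * K * M \<le> M / 2\<close>. The positions
  \<open>s\<close> and \<open>s'\<close> are arbitrary, so the gap of two leaves at 0 and their gap
  elsewhere bound each other.\<close>

lemma ode_solution_comparison:
  fixes h :: "real \<Rightarrow> real \<Rightarrow> real"
  assumes u: "\<And>s. s \<in> {-r..r} \<Longrightarrow> (u has_real_derivative h s (u s)) (at s within {-r..r})"
    and v: "\<And>s. s \<in> {-r..r} \<Longrightarrow> (v has_real_derivative h s (v s)) (at s within {-r..r})"
    and uv: "\<And>s. s \<in> {-r..r} \<Longrightarrow> u s \<in> {-r..r} \<and> v s \<in> {-r..r}"
    and lip: "\<And>s t t'. s \<in> {-r..r} \<Longrightarrow> t \<in> {-r..r} \<Longrightarrow> t' \<in> {-r..r} \<Longrightarrow> \<bar>h s t - h s t'\<bar> \<le> K * \<bar>t - t'\<bar>"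
    and K: "0 \<le> K" "r * K \<le> 1 / 4"
    and s: "s \<in> {-r..r}" "s' \<in> {-r..r}"
  shows "\<bar>u s - v s\<bar> \<le> 2 * \<bar>u s' - v s'\<bar>"
proof -
  have cont: "continuous_on {-r..r} (\<lambda>s. \<bar>u s - v s\<bar>)"
    by (intro continuous_intros DERIV_continuous_on[OF u] DERIV_continuous_on[OF v])
  obtain x where x: "x \<in> {-r..r}" and max: "\<And>y. y \<in> {-r..r} \<Longrightarrow> \<bar>u y - v y\<bar> \<le> \<bar>u x - v x\<bar>"
    using continuous_attains_sup[OF _ _ cont] s by fastforce
  define M where "M = \<bar>u x - v x\<bar>"
  have "\<bar>(u x - v x) - (u s' - v s')\<bar> \<le> (K * M) * \<bar>x - s'\<bar>"
  proof (rule real_derivative_bound[where f = "\<lambda>s. u s - v s" and a = "-r" and b = r])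
    show "((\<lambda>s. u s - v s) has_real_derivative h y (u y) - h y (v y)) (at y within {-r..r})"
      if "y \<in> {-r..r}" for y
      using u[OF that] v[OF that] by (rule DERIV_diff)
    show "\<bar>h y (u y) - h y (v y)\<bar> \<le> K * M" if "y \<in> {-r..r}" for y
      using lip[OF that, of "u y" "v y"] uv[OF that] max[OF that] K(1) unfolding M_def
      by (smt (verit) mult_left_mono)
  qed (use x s in auto)
  also have "\<dots> \<le> (K * M) * (2 * r)"
    using x s K by (intro mult_left_mono mult_nonneg_nonneg) (auto simp: M_def)
  also have "\<dots> = 2 * (r * K) * M" by simp
  also have "\<dots> \<le> 1 / 2 * M" using K by (intro mult_right_mono) (auto simp: M_def)
  finally have "M \<le> 2 * \<bar>u s' - v s'\<bar>"
    using abs_triangle_ineq2[of "u x - v x" "u s' - v s'"] unfolding M_def by argo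
  then show ?thesis using max[OF s(1)] unfolding M_def by linarith
qed

text \<open>Clipping makes the Picard operator act on all bounded continuous functions on the line,
  a complete metric type on which the contraction principle applies directly.\<close>

definition clip :: "real \<Rightarrow> real \<Rightarrow> real" where
  "clip r x = max (- r) (min r x)"

lemma clip_mem: "0 \<le> r \<Longrightarrow> clip r x \<in> {-r..r}"
  by (auto simp: clip_def)

lemma clip_id: "x \<in> {-r..r} \<Longrightarrow> clip r x = x"
  by (auto simp: clip_def)

lemma clip_nonexpansive: "\<bar>clip r x - clip r y\<bar> \<le> \<bar>x - y\<bar>"
  by (auto simp: clip_def max_def min_def)

lemma continuous_clip: "continuous_on S (clip r)"
  unfolding clip_def by (intro continuous_intros)

text \<open>Picard iteration with contraction factor \<open>2 * r * K \<le> 1 / 2\<close>. A slope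
  of at most 1/4 over a length of at most \<open>2 * r\<close>, starting from
  \<open>\<bar>q\<bar> \<le> r / 2\<close>, keeps the fixed point in \<open>{-r..r}\<close>, where
  clipping changes nothing.\<close>

lemma ode_solution_exists:
  fixes h :: "real \<Rightarrow> real \<Rightarrow> real"
  assumes r: "0 < r"
    and cont: "continuous_on ({-r..r} \<times> {-r..r}) (\<lambda>(s, t). h s t)"
    and lip: "\<And>s t t'. s \<in> {-r..r} \<Longrightarrow> t \<in> {-r..r} \<Longrightarrow> t' \<in> {-r..r} \<Longrightarrow> \<bar>h s t - h s t'\<bar> \<le> K * \<bar>t - t'\<bar>"
    and K: "0 \<le> K" "r * K \<le> 1 / 4"
    and bd: "\<And>s t. s \<in> {-r..r} \<Longrightarrow> t \<in> {-r..r} \<Longrightarrow> \<bar>h s t\<bar> \<le> 1 / 4"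
    and init: "p \<in> {-r..r}" "\<bar>q\<bar> \<le> r / 2"
  obtains u where "u p = q" "\<And>s. s \<in> {-r..r} \<Longrightarrow> u s \<in> {-r..r}"
    "\<And>s. s \<in> {-r..r} \<Longrightarrow> (u has_real_derivative h s (u s)) (at s within {-r..r})"
proof -
  define G :: "(real \<Rightarrow>\<^sub>C real) \<Rightarrow> real \<Rightarrow> real"
    where "G w s = integral {-r..s} (\<lambda>x. h x (clip r (w x)))" for w s
  have clip_r: "clip r x \<in> {-r..r}" for x using r by (intro clip_mem) simp
  have G_deriv: "(G w has_real_derivative h s (clip r (w s))) (at s within {-r..r})"
    if "s \<in> {-r..r}" for w s
  proof -
    have "continuous_on {-r..r} ((\<lambda>(s, t). h s t) \<circ> (\<lambda>x. (x, clip r (w x))))"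
    proof (rule continuous_on_compose)
      show "continuous_on {-r..r} (\<lambda>x. (x, clip r (w x)))"
        by (intro continuous_intros continuous_on_compose2[OF continuous_clip[of UNIV]]) auto
      show "continuous_on ((\<lambda>x. (x, clip r (w x))) ` {-r..r}) (\<lambda>(s, t). h s t)"
        by (rule continuous_on_subset[OF cont]) (use clip_r in auto)
    qed
    then have "continuous_on {-r..r} (\<lambda>x. h x (clip r (w x)))" by (simp add: o_def)
    then show ?thesis unfolding G_def by (rule integral_has_real_derivative) (rule that)
  qed
  have G_bound: "\<bar>G w s - G w s'\<bar> \<le> 1 / 4 * \<bar>s - s'\<bar>" if "s \<in> {-r..r}" "s' \<in> {-r..r}" for w s s'
    by (rule real_derivative_bound[OF G_deriv bd that]) (use clip_r in auto)
  have G_contr: "\<bar>(G v s - G v s') - (G w s - G w s')\<bar> \<le> 1 / 2 * dist v w"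
    if s: "s \<in> {-r..r}" "s' \<in> {-r..r}" for v w s s'
  proof -
    have "\<bar>(G v s - G w s) - (G v s' - G w s')\<bar> \<le> (K * dist v w) * \<bar>s - s'\<bar>"
    proof (rule real_derivative_bound[where f = "\<lambda>s. G v s - G w s" and a = "-r" and b = r])
      show "((\<lambda>s. G v s - G w s) has_real_derivative h x (clip r (v x)) - h x (clip r (w x)))
          (at x within {-r..r})" if "x \<in> {-r..r}" for x
        by (intro DERIV_diff G_deriv that)
      show "\<bar>h x (clip r (v x)) - h x (clip r (w x))\<bar> \<le> K * dist v w" if "x \<in> {-r..r}" for x
      proof -
        have "\<bar>h x (clip r (v x)) - h x (clip r (w x))\<bar> \<le> K * \<bar>clip r (v x) - clip r (w x)\<bar>"
          by (rule lip[OF that clip_r clip_r])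
        also have "\<bar>clip r (v x) - clip r (w x)\<bar> \<le> dist v w"
          using clip_nonexpansive[of r "v x" "w x"] dist_bounded[of v x w] by (simp add: dist_real_def)
        finally show ?thesis using K(1) by (simp add: mult_left_mono)
      qed
    qed (use s in auto)
    also have "\<dots> \<le> (K * dist v w) * (2 * r)"
      using s K by (intro mult_left_mono mult_nonneg_nonneg) auto
    also have "\<dots> = 2 * (r * K) * dist v w" by simp
    also have "\<dots> \<le> 1 / 2 * dist v w" using K by (intro mult_right_mono) auto
    finally show ?thesis by (simp add: algebra_simps)
  qed
  \<comment> \<open>The integral \<open>G\<close> starts at \<open>-r\<close>; subtracting its value
    at \<open>p\<close> moves the initial condition to \<open>p\<close>. Clipping \<open>s\<close>
    extends the function continuously to the whole line.\<close>
  define F where "F w s = q + (G w (clip r s) - G w p)" for w s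
  have F_bcontfun: "F w \<in> bcontfun" for w
  proof (rule bcontfun_normI)
    have "continuous_on {-r..r} (G w)" by (rule DERIV_continuous_on[OF G_deriv])
    then have "continuous_on UNIV (\<lambda>s. G w (clip r s))"
      by (rule continuous_on_compose2[OF _ continuous_clip]) (use clip_r in auto)
    then show "continuous_on UNIV (F w)" unfolding F_def by (intro continuous_intros)
    show "norm (F w s) \<le> \<bar>q\<bar> + 1 / 4 * (2 * r)" for s
    proof -
      have "\<bar>G w (clip r s) - G w p\<bar> \<le> 1 / 4 * \<bar>clip r s - p\<bar>" by (intro G_bound clip_r init)
      also have "\<dots> \<le> 1 / 4 * (2 * r)" using clip_r[of s] init by auto
      finally show ?thesis
        unfolding F_def real_norm_def using abs_triangle_ineq[of q "G w (clip r s) - G w p"] by argo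
    qed
  qed
  have "\<exists>!w. Bcontfun (F w) = w"
  proof (rule banach_fix_type[of "1 / 2"])
    show "\<forall>v w. dist (Bcontfun (F v)) (Bcontfun (F w)) \<le> 1 / 2 * dist v w"
    proof (intro allI dist_bound)
      fix v w s
      show "dist (Bcontfun (F v) s) (Bcontfun (F w) s) \<le> 1 / 2 * dist v w"
        unfolding Bcontfun_inverse[OF F_bcontfun] dist_real_def F_def
        using G_contr[OF clip_r[of s] init(1), of v w] by simp
    qed
  qed auto
  then obtain w where "Bcontfun (F w) = w" by blast
  then have w: "w s = q + (G w (clip r s) - G w p)" for s
    using Bcontfun_inverse[OF F_bcontfun, of w] unfolding F_def by metis
  show ?thesis
  proof
    show "w p = q" unfolding w[of p] using clip_id[OF init(1)] by simp
    show mem: "w s \<in> {-r..r}" if "s \<in> {-r..r}" for s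
    proof -
      have "\<bar>G w s - G w p\<bar> \<le> 1 / 4 * \<bar>s - p\<bar>" by (intro G_bound that init)
      moreover have "\<bar>s - p\<bar> \<le> 2 * r" using that init by auto
      ultimately have "\<bar>w s\<bar> \<le> r"
        using init(2) abs_triangle_ineq[of q "G w s - G w p"] unfolding w[of s] clip_id[OF that] by argo
      then show ?thesis by auto
    qed
    show "(w has_real_derivative h s (w s)) (at s within {-r..r})" if "s \<in> {-r..r}" for s
    proof -
      have "((\<lambda>s. q + (G w s - G w p)) has_real_derivative h s (w s)) (at s within {-r..r})"
        by (rule derivative_eq_intros G_deriv[OF that, of w] refl)+
          (simp add: clip_id[OF mem[OF that]])
      then show ?thesis
        by (rule has_field_derivative_transform_within[where d = 1]) (use that w clip_id in auto)
    qed
  qed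
qed

section \<open>The Koranyi metric along horizontal curves\<close>

text \<open>This is the vertical coordinate of the product of the inverse of \<open>b\<close> with
  \<open>a\<close> in the Heisenberg group.\<close>

definition twist :: "real^3 \<Rightarrow> real^3 \<Rightarrow> real" where
  "twist a b = a$3 - b$3 + (a$1 * b$2 - b$1 * a$2) / 2"

lemma koranyi_twist:
  "koranyi a b = root 4 (((a$1 - b$1)\<^sup>2 + (a$2 - b$2)\<^sup>2)\<^sup>2 + 16 * (twist a b)\<^sup>2)"
  by (simp add: koranyi_def twist_def)

text \<open>The group law for the displacement from \<open>b\<close> to \<open>a\<close> split at
  \<open>p\<close>: vertical coordinates add up to a symplectic term in the horizontal
  displacements.\<close>

lemma twist_chain:
  "twist a b = twist a p + twist p b + ((a$1 - p$1) * (b$2 - p$2) - (b$1 - p$1) * (a$2 - p$2)) / 2"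
  by (simp add: twist_def field_simps)

lemma root4_le: "0 \<le> m \<Longrightarrow> x \<le> m ^ 4 \<Longrightarrow> root 4 x \<le> m"
  by (metis real_root_le_mono real_root_power_cancel zero_less_numeral)

lemma root4_ge: "0 \<le> m \<Longrightarrow> m ^ 4 \<le> x \<Longrightarrow> m \<le> root 4 x"
  by (metis real_root_le_mono real_root_power_cancel zero_less_numeral)

lemma abs_le_imp_square_le:
  fixes x :: real
  shows "\<bar>x\<bar> \<le> c \<Longrightarrow> x\<^sup>2 \<le> c\<^sup>2"
  by (metis abs_ge_zero power2_abs power_mono)

text \<open>Here \<open>\<sigma>\<close> models the horizontal displacement and
  \<open>\<tau>\<close> the vertical one. If \<open>\<bar>\<sigma>\<bar>\<close> dominates, the
  first coordinate alone gives the lower bound, otherwise the twist does; the errors take away at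
  most half of the dominating term.\<close>

lemma koranyi_comparison:
  assumes x: "\<bar>a$1 - b$1 - \<sigma>\<bar> \<le> \<bar>\<sigma>\<bar> / 4 + sqrt \<bar>\<tau>\<bar> / 4"
    and y: "\<bar>a$2 - b$2\<bar> \<le> 2 * \<bar>\<sigma>\<bar> + sqrt \<bar>\<tau>\<bar>"
    and z: "\<bar>twist a b - \<tau>\<bar> \<le> \<sigma>\<^sup>2 / 4 + \<bar>\<tau>\<bar> / 4"
  shows "max \<bar>\<sigma>\<bar> (sqrt \<bar>\<tau>\<bar>) / 2 \<le> koranyi a b" and "koranyi a b \<le> 4 * max \<bar>\<sigma>\<bar> (sqrt \<bar>\<tau>\<bar>)"
proof -
  define A q m where "A = \<bar>\<sigma>\<bar>" and "q = sqrt \<bar>\<tau>\<bar>" and "m = max A q"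
  have q: "0 \<le> q" "q\<^sup>2 = \<bar>\<tau>\<bar>" and A: "0 \<le> A" "A\<^sup>2 = \<sigma>\<^sup>2" by (auto simp: q_def A_def)
  have m: "0 \<le> m" "A \<le> m" "q \<le> m" using A by (auto simp: m_def)
  have mm: "max \<bar>\<sigma>\<bar> (sqrt \<bar>\<tau>\<bar>) = m" by (simp add: m_def A_def q_def)
  have sq: "A\<^sup>2 \<le> m\<^sup>2" "q\<^sup>2 \<le> m\<^sup>2" using A(1) q(1) m(2,3) by (simp_all add: power_mono)
  define X Y Z where "X = a$1 - b$1" and "Y = a$2 - b$2" and "Z = twist a b"
  have XYZ: "\<bar>X - \<sigma>\<bar> \<le> A / 4 + q / 4" "\<bar>Y\<bar> \<le> 2 * A + q" "\<bar>Z - \<tau>\<bar> \<le> A\<^sup>2 / 4 + q\<^sup>2 / 4"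
    using x y z by (simp_all add: X_def Y_def Z_def A_def q_def)
  have k: "koranyi a b = root 4 ((X\<^sup>2 + Y\<^sup>2)\<^sup>2 + 16 * Z\<^sup>2)"
    by (simp add: koranyi_twist X_def Y_def Z_def)
  show "koranyi a b \<le> 4 * max \<bar>\<sigma>\<bar> (sqrt \<bar>\<tau>\<bar>)"
  proof -
    have "\<bar>X\<bar> \<le> 3 / 2 * m"
      using abs_triangle_ineq[of "X - \<sigma>" \<sigma>] XYZ(1) m by (simp add: A_def)
    then have "X\<^sup>2 \<le> (3 / 2 * m)\<^sup>2" by (rule abs_le_imp_square_le)
    moreover have "\<bar>Y\<bar> \<le> 3 * m" using XYZ(2) m by linarith
    then have "Y\<^sup>2 \<le> (3 * m)\<^sup>2" by (rule abs_le_imp_square_le)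
    ultimately have "X\<^sup>2 + Y\<^sup>2 \<le> 12 * m\<^sup>2"
      by (simp add: power_mult_distrib power_divide) (use zero_le_power2[of m] in linarith)
    then have "(X\<^sup>2 + Y\<^sup>2)\<^sup>2 \<le> (12 * m\<^sup>2)\<^sup>2" by (intro power_mono) auto
    moreover have "\<bar>Z\<bar> \<le> 3 / 2 * m\<^sup>2"
      using abs_triangle_ineq[of "Z - \<tau>" \<tau>] XYZ(3) sq q(2) by simp
    then have "Z\<^sup>2 \<le> (3 / 2 * m\<^sup>2)\<^sup>2" by (rule abs_le_imp_square_le)
    \<comment> \<open>The constants fit because
      \<open>12\<^sup>2 + 16 * (3 / 2)\<^sup>2 = 180\<close> is below
      \<open>4 ^ 4 = 256\<close>.\<close>
    ultimately have "(X\<^sup>2 + Y\<^sup>2)\<^sup>2 + 16 * Z\<^sup>2 \<le> (4 * m) ^ 4"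
      by (simp add: power_mult_distrib power_divide flip: power_mult)
        (use zero_le_power[OF m(1), of 4] in linarith)
    then show ?thesis unfolding k mm using m(1) by (intro root4_le) simp_all
  qed
  show "max \<bar>\<sigma>\<bar> (sqrt \<bar>\<tau>\<bar>) / 2 \<le> koranyi a b"
  proof -
    have "(m / 2) ^ 4 \<le> (X\<^sup>2 + Y\<^sup>2)\<^sup>2 + 16 * Z\<^sup>2"
    proof (cases "q \<le> A")
      case True
      then have "m / 2 \<le> \<bar>X\<bar>"
        using abs_triangle_ineq2_sym[of \<sigma> X] XYZ(1) unfolding m_def by (simp add: A_def)
      then have "(m / 2) ^ 4 \<le> \<bar>X\<bar> ^ 4" using m by (intro power_mono) auto
      also have "\<dots> = (X\<^sup>2)\<^sup>2" by (simp flip: power_mult)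
      also have "\<dots> \<le> (X\<^sup>2 + Y\<^sup>2)\<^sup>2" by (intro power_mono) auto
      finally show ?thesis by (smt (verit) zero_le_power2)
    next
      case False
      then have "A\<^sup>2 \<le> q\<^sup>2" using A by (intro power_mono) auto
      moreover have "m = q" using False by (simp add: m_def)
      ultimately have "m\<^sup>2 / 2 \<le> \<bar>Z\<bar>"
        using XYZ(3) q(2) abs_triangle_ineq2_sym[of \<tau> Z] by simp
      then have "(m\<^sup>2 / 2)\<^sup>2 \<le> \<bar>Z\<bar>\<^sup>2" by (intro power_mono) auto
      then have Z: "4 * m ^ 4 \<le> 16 * Z\<^sup>2" by (simp add: power_divide flip: power_mult)
      have "(m / 2) ^ 4 \<le> 4 * m ^ 4"
        using zero_le_power[OF m(1), of 4] by (simp add: power_divide)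
      also have "\<dots> \<le> 16 * Z\<^sup>2" by (rule Z)
      also have "\<dots> \<le> (X\<^sup>2 + Y\<^sup>2)\<^sup>2 + 16 * Z\<^sup>2" by simp
      finally show ?thesis .
    qed
    then show ?thesis unfolding k mm using m(1) by (intro root4_ge) simp_all
  qed
qed

lemma abs_prod_le:
  fixes x y :: real
  shows "\<bar>x\<bar> \<le> a \<Longrightarrow> \<bar>y\<bar> \<le> b \<Longrightarrow> \<bar>x * y\<bar> \<le> a * b"
  unfolding abs_mult by (intro mult_mono) auto

text \<open>The point \<open>p\<close> lies on the leaf through \<open>b\<close> and on the transversal through \<open>a\<close>.\<close>

lemma koranyi_via_leaf_point:
  assumes ap: "\<bar>a$1 - p$1\<bar> \<le> \<bar>\<tau>\<bar> / 100" "\<bar>a$2 - p$2\<bar> \<le> N * \<bar>\<tau>\<bar>" "\<bar>a$3 - p$3 - \<tau>\<bar> \<le> \<bar>\<tau>\<bar> / 100"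
    and pb: "\<bar>p$1 - b$1 - \<sigma>\<bar> \<le> \<bar>\<sigma>\<bar> / 100" "\<bar>p$2 - b$2\<bar> \<le> 2 * \<bar>\<sigma>\<bar>" "\<bar>twist p b\<bar> \<le> \<sigma>\<^sup>2 / 20"
    and small: "N * \<bar>p$1\<bar> \<le> 1 / 100" "\<bar>p$2\<bar> \<le> 1" "N * \<bar>\<sigma>\<bar> \<le> 1 / 100" "N\<^sup>2 * \<bar>\<tau>\<bar> \<le> 1 / 16"
    and N: "1 \<le> N"
  shows "max \<bar>\<sigma>\<bar> (sqrt \<bar>\<tau>\<bar>) / 2 \<le> koranyi a b" and "koranyi a b \<le> 4 * max \<bar>\<sigma>\<bar> (sqrt \<bar>\<tau>\<bar>)"
proof -
  define A B where "A = \<bar>\<sigma>\<bar>" and "B = \<bar>\<tau>\<bar>"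
  have AB: "0 \<le> A" "0 \<le> B" by (auto simp: A_def B_def)
  \<comment> \<open>The transversal may be steep in the second coordinate, but a shift of order
    \<open>N * \<bar>\<tau>\<bar>\<close> is below a quarter of
    \<open>sqrt \<bar>\<tau>\<bar>\<close> near the base point. This keeps \<open>N\<close> out of
    the constants.\<close>
  have NB: "N * B \<le> sqrt B / 4"
  proof -
    have "(N * B)\<^sup>2 = (N\<^sup>2 * B) * B" by (simp add: power2_eq_square)
    also have "\<dots> \<le> 1 / 16 * B" using small(4) AB by (intro mult_right_mono) (auto simp: B_def)
    also have "\<dots> = (sqrt B / 4)\<^sup>2" using AB by (simp add: power_divide)
    finally have "(N * B)\<^sup>2 \<le> (sqrt B / 4)\<^sup>2" .
    then show ?thesis by (rule power2_le_imp_le) (use AB in simp)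
  qed
  have B_NB: "B \<le> N * B" using mult_right_mono[OF N AB(2)] by simp
  have A1: "A \<le> 1 / 100" using mult_right_mono[OF N AB(1)] small(3) unfolding A_def by simp
  have x: "\<bar>a$1 - b$1 - \<sigma>\<bar> \<le> \<bar>\<sigma>\<bar> / 4 + sqrt \<bar>\<tau>\<bar> / 4"
    using ap(1) pb(1) NB B_NB AB unfolding A_def B_def by argo
  have y: "\<bar>a$2 - b$2\<bar> \<le> 2 * \<bar>\<sigma>\<bar> + sqrt \<bar>\<tau>\<bar>"
    using ap(2) pb(2) NB real_sqrt_ge_zero[OF AB(2)]
    unfolding A_def B_def by argo
  have "\<bar>(a$1 - p$1) * p$2\<bar> \<le> B / 100 * 1"
    by (rule abs_prod_le) (use ap small in \<open>auto simp: B_def\<close>)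
  moreover have "\<bar>p$1 * (a$2 - p$2)\<bar> \<le> B / 100"
  proof -
    have "\<bar>p$1 * (a$2 - p$2)\<bar> \<le> \<bar>p$1\<bar> * (N * B)"
      by (rule abs_prod_le) (use ap in \<open>auto simp: B_def\<close>)
    also have "\<dots> = (N * \<bar>p$1\<bar>) * B" by simp
    also have "\<dots> \<le> 1 / 100 * B" using small AB by (intro mult_right_mono)
    finally show ?thesis by simp
  qed
  moreover have "twist a p = (a$3 - p$3) + ((a$1 - p$1) * p$2 - p$1 * (a$2 - p$2)) / 2"
    by (simp add: twist_def algebra_simps)
  ultimately have tap: "\<bar>twist a p - \<tau>\<bar> \<le> B / 50" using ap(3) unfolding B_def by argo
  \<comment> \<open>The next two estimates treat the symplectic term of
    \<open>twist_chain\<close>.\<close>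
  have "\<bar>(a$1 - p$1) * (b$2 - p$2)\<bar> \<le> B / 100 * (2 * A)"
    by (rule abs_prod_le) (use ap pb in \<open>auto simp: A_def B_def abs_minus_commute\<close>)
  also have "\<dots> \<le> B / 100 * 1" using A1 AB by (intro mult_left_mono) auto
  finally have c1: "\<bar>(a$1 - p$1) * (b$2 - p$2)\<bar> \<le> B / 100" by simp
  have "\<bar>(b$1 - p$1) * (a$2 - p$2)\<bar> \<le> (2 * A) * (N * B)"
  proof (rule abs_prod_le)
    show "\<bar>b$1 - p$1\<bar> \<le> 2 * A" using pb(1) AB A_def by argo
  qed (use ap in \<open>auto simp: B_def\<close>)
  also have "\<dots> = 2 * (N * A) * B" by simp
  also have "\<dots> \<le> 2 * (1 / 100) * B" using small AB unfolding A_def by (intro mult_right_mono mult_left_mono) auto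
  finally have c2: "\<bar>(b$1 - p$1) * (a$2 - p$2)\<bar> \<le> B / 50" by simp
  have "0 \<le> \<sigma>\<^sup>2" by simp
  then have z: "\<bar>twist a b - \<tau>\<bar> \<le> \<sigma>\<^sup>2 / 4 + \<bar>\<tau>\<bar> / 4"
    unfolding twist_chain[of a b p] using tap pb(3) c1 c2 AB unfolding B_def by argo
  show "max \<bar>\<sigma>\<bar> (sqrt \<bar>\<tau>\<bar>) / 2 \<le> koranyi a b" "koranyi a b \<le> 4 * max \<bar>\<sigma>\<bar> (sqrt \<bar>\<tau>\<bar>)"
    using koranyi_comparison[OF x y z] .
qed

text \<open>Two points of a straight horizontal line have twist 0. The projected velocity stays
  within 1/100 of \<open>(1, \<beta>)\<close> in each coordinate, so the twist from
  \<open>g s'\<close> grows at a rate that is a small multiple of the distance to \<open>s'\<close>;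
  integration makes it quadratic.\<close>

lemma horizontal_curve_twist:
  fixes g :: "real \<Rightarrow> real^3" and x' y' z' :: "real \<Rightarrow> real"
  assumes dx: "\<And>s. s \<in> {-r..r} \<Longrightarrow> ((\<lambda>s. g s $ 1) has_real_derivative x' s) (at s within {-r..r})"
    and dy: "\<And>s. s \<in> {-r..r} \<Longrightarrow> ((\<lambda>s. g s $ 2) has_real_derivative y' s) (at s within {-r..r})"
    and dz: "\<And>s. s \<in> {-r..r} \<Longrightarrow> ((\<lambda>s. g s $ 3) has_real_derivative z' s) (at s within {-r..r})"
    and horizontal: "\<And>s. s \<in> {-r..r} \<Longrightarrow> z' s = (g s $ 1 * y' s - g s $ 2 * x' s) / 2"
    and bx: "\<And>s. s \<in> {-r..r} \<Longrightarrow> \<bar>x' s - 1\<bar> \<le> 1 / 100"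
    and by': "\<And>s. s \<in> {-r..r} \<Longrightarrow> \<bar>y' s - \<beta>\<bar> \<le> 1 / 100"
    and \<beta>: "\<bar>\<beta>\<bar> \<le> 1" and s: "s \<in> {-r..r}" "s' \<in> {-r..r}"
  shows "\<bar>g s $ 1 - g s' $ 1 - (s - s')\<bar> \<le> \<bar>s - s'\<bar> / 100"
    and "\<bar>g s $ 2 - g s' $ 2\<bar> \<le> 2 * \<bar>s - s'\<bar>"
    and "\<bar>twist (g s) (g s')\<bar> \<le> (s - s')\<^sup>2 / 20"
proof -
  have X: "\<bar>g s $ 1 - g s' $ 1 - (s - s')\<bar> \<le> 1 / 100 * \<bar>s - s'\<bar>" if "s \<in> {-r..r}" "s' \<in> {-r..r}" for s s'
    using real_derivative_bound[where f = "\<lambda>s. g s $ 1 - s", OF DERIV_diff[OF dx DERIV_ident] bx that]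
    by (simp add: algebra_simps)
  have Y: "\<bar>g s $ 2 - g s' $ 2 - \<beta> * (s - s')\<bar> \<le> 1 / 100 * \<bar>s - s'\<bar>" if "s \<in> {-r..r}" "s' \<in> {-r..r}" for s s'
    using real_derivative_bound[where f = "\<lambda>s. g s $ 2 - s * \<beta>",
        OF DERIV_diff[OF dy DERIV_cmult_right[OF DERIV_ident, simplified]] by' that]
    by (simp add: algebra_simps)
  show "\<bar>g s $ 1 - g s' $ 1 - (s - s')\<bar> \<le> \<bar>s - s'\<bar> / 100" using X[OF s] by simp
  have \<beta>': "\<bar>\<beta> * (u - v)\<bar> \<le> \<bar>u - v\<bar>" for u v
    using mult_right_mono[OF \<beta>, of "\<bar>u - v\<bar>"] by (simp add: abs_mult)
  show "\<bar>g s $ 2 - g s' $ 2\<bar> \<le> 2 * \<bar>s - s'\<bar>" 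
  proof -
    have "\<bar>g s $ 2 - g s' $ 2\<bar> \<le> \<bar>g s $ 2 - g s' $ 2 - \<beta> * (s - s')\<bar> + \<bar>\<beta> * (s - s')\<bar>"
      using abs_triangle_ineq[of "g s $ 2 - g s' $ 2 - \<beta> * (s - s')" "\<beta> * (s - s')"] by simp
    also have "\<dots> \<le> 1 / 100 * \<bar>s - s'\<bar> + \<bar>s - s'\<bar>" by (intro add_mono Y[OF s] \<beta>')
    finally show ?thesis by argo
  qed
  define I where "I = {min s s'..max s s'}"
  have I: "I \<subseteq> {-r..r}" using s by (auto simp: I_def)
  define f where "f u = twist (g u) (g s')" for u
  \<comment> \<open>This is the derivative of \<open>f\<close> with \<open>z'\<close> eliminated by
    horizontality. Only differences from \<open>g s'\<close> remain, as left invariance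
    predicts.\<close>
  define f' where "f' u = ((g u $ 1 - g s' $ 1) * y' u - (g u $ 2 - g s' $ 2) * x' u) / 2" for u
  have "\<bar>f s - f s'\<bar> \<le> (\<bar>s - s'\<bar> / 20) * \<bar>s - s'\<bar>"
  proof (rule real_derivative_bound[where a = "min s s'" and b = "max s s'"])
    fix u assume "u \<in> {min s s'..max s s'}"
    then have u: "u \<in> {-r..r}" and us: "\<bar>u - s'\<bar> \<le> \<bar>s - s'\<bar>" using I by (auto simp: I_def)
    have "(f has_real_derivative (z' u - 0) + (x' u * g s' $ 2 - g s' $ 1 * y' u) / 2) (at u within {-r..r})"
      unfolding f_def twist_def
      by (intro DERIV_add DERIV_diff DERIV_cdivide DERIV_cmult DERIV_cmult_right dx dy dz DERIV_const u)
    moreover have "(z' u - 0) + (x' u * g s' $ 2 - g s' $ 1 * y' u) / 2 = f' u"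
      unfolding horizontal[OF u] f'_def by (simp add: field_simps)
    ultimately show "(f has_real_derivative f' u) (at u within {min s s'..max s s'})"
      using I unfolding I_def by (metis DERIV_subset)
    define d e1 e2 e3 e4 where "d = u - s'" and "e1 = g u $ 1 - g s' $ 1 - d"
      and "e2 = g u $ 2 - g s' $ 2 - \<beta> * d" and "e3 = y' u - \<beta>" and "e4 = x' u - 1"
    have e: "\<bar>e1\<bar> \<le> 1 / 100 * \<bar>d\<bar>" "\<bar>e2\<bar> \<le> 1 / 100 * \<bar>d\<bar>" "\<bar>e3\<bar> \<le> 1 / 100" "\<bar>e4\<bar> \<le> 1 / 100"
      using X[OF u s(2)] Y[OF u s(2)] bx[OF u] by'[OF u] unfolding d_def e1_def e2_def e3_def e4_def by auto
    \<comment> \<open>The main terms \<open>d * \<beta>\<close> cancel, and every remaining term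
      contains one of the errors \<open>e1\<close> to \<open>e4\<close>.\<close>
    have "f' u = (d * e3 + e1 * \<beta> + e1 * e3 - e2 - \<beta> * (d * e4) - e2 * e4) / 2"
    proof -
      have "g u $ 1 - g s' $ 1 = d + e1" "g u $ 2 - g s' $ 2 = \<beta> * d + e2" "y' u = \<beta> + e3" "x' u = 1 + e4"
        by (simp_all add: e1_def e2_def e3_def e4_def)
      then show ?thesis unfolding f'_def by (simp add: algebra_simps)
    qed
    moreover have "\<bar>d * e3\<bar> \<le> \<bar>d\<bar> * (1 / 100)" "\<bar>e1 * \<beta>\<bar> \<le> (1 / 100 * \<bar>d\<bar>) * 1"
      "\<bar>e1 * e3\<bar> \<le> (1 / 100 * \<bar>d\<bar>) * (1 / 100)" "\<bar>\<beta> * (d * e4)\<bar> \<le> 1 * (\<bar>d\<bar> * (1 / 100))"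
      "\<bar>e2 * e4\<bar> \<le> (1 / 100 * \<bar>d\<bar>) * (1 / 100)"
      using e \<beta> by (intro abs_prod_le; simp)+
    ultimately have "\<bar>f' u\<bar> \<le> \<bar>d\<bar> / 20" using e(2) by argo
    then show "\<bar>f' u\<bar> \<le> \<bar>s - s'\<bar> / 20" using us unfolding d_def by argo
  qed auto
  moreover have "f s' = 0" by (simp add: f_def twist_def)
  moreover have "\<bar>s - s'\<bar> / 20 * \<bar>s - s'\<bar> = (s - s')\<^sup>2 / 20"
    by (simp add: power2_eq_square flip: abs_mult)
  ultimately show "\<bar>twist (g s) (g s')\<bar> \<le> (s - s')\<^sup>2 / 20" by (simp add: f_def)
qed

section \<open>Normalised patches\<close>

lemma product_lipschitz:
  fixes f g :: "'a::metric_space \<Rightarrow> real"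
  assumes "compact S" "\<exists>K. K-lipschitz_on S f" "\<exists>K. K-lipschitz_on S g"
  shows "\<exists>K. K-lipschitz_on S (\<lambda>x. f x * g x)"
proof -
  obtain K1 K2 where K: "K1-lipschitz_on S f" "K2-lipschitz_on S g" using assms by blast
  have "bounded (f ` S)" "bounded (g ` S)"
    using K assms(1) by (auto intro!: compact_imp_bounded compact_continuous_image lipschitz_on_continuous_on)
  then obtain A B where A: "\<And>x. x \<in> S \<Longrightarrow> \<bar>f x\<bar> \<le> A" and B: "\<And>x. x \<in> S \<Longrightarrow> \<bar>g x\<bar> \<le> B"
    unfolding bounded_iff by auto
  have "(\<bar>B\<bar> * K1 + \<bar>A\<bar> * K2)-lipschitz_on S (\<lambda>x. f x * g x)"
  proof (rule lipschitz_onI)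
    fix x y assume xy: "x \<in> S" "y \<in> S"
    have "\<bar>f x * g x - f y * g y\<bar> = \<bar>(f x - f y) * g x + f y * (g x - g y)\<bar>" by (simp add: algebra_simps)
    also have "\<dots> \<le> \<bar>(f x - f y) * g x\<bar> + \<bar>f y * (g x - g y)\<bar>" by (rule abs_triangle_ineq)
    also have "\<dots> \<le> (K1 * dist x y) * \<bar>B\<bar> + \<bar>A\<bar> * (K2 * dist x y)"
    proof (intro add_mono abs_prod_le)
      show "\<bar>f x - f y\<bar> \<le> K1 * dist x y" "\<bar>g x - g y\<bar> \<le> K2 * dist x y"
        using lipschitz_onD[OF K(1) xy] lipschitz_onD[OF K(2) xy] by (simp_all add: dist_real_def)
      show "\<bar>g x\<bar> \<le> \<bar>B\<bar>" "\<bar>f y\<bar> \<le> \<bar>A\<bar>" using A[OF xy(2)] B[OF xy(1)] by auto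
    qed
    finally show "dist (f x * g x) (f y * g y) \<le> (\<bar>B\<bar> * K1 + \<bar>A\<bar> * K2) * dist x y"
      by (simp add: dist_real_def algebra_simps)
  qed (use lipschitz_on_nonneg[OF K(1)] lipschitz_on_nonneg[OF K(2)] in simp)
  then show ?thesis by blast
qed

lemma inverse_lipschitz:
  fixes f :: "'a::metric_space \<Rightarrow> real"
  assumes "K-lipschitz_on S f" and lower: "\<And>x. x \<in> S \<Longrightarrow> 1 / 2 \<le> f x"
  shows "(4 * K)-lipschitz_on S (\<lambda>x. 1 / f x)"
proof (rule lipschitz_onI)
  fix x y assume xy: "x \<in> S" "y \<in> S"
  have pos: "1 / 2 \<le> f x" "1 / 2 \<le> f y" using lower xy by auto
  have "dist (1 / f x) (1 / f y) = \<bar>f x - f y\<bar> / (f x * f y)"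
    using pos by (simp add: dist_real_def field_simps abs_minus_commute)
  also have "\<dots> \<le> \<bar>f x - f y\<bar> / (1 / 2 * (1 / 2))"
    by (intro divide_left_mono mult_mono mult_pos_pos) (use pos in auto)
  also have "\<dots> \<le> 4 * (K * dist x y)"
    using lipschitz_onD[OF assms(1) xy] by (simp add: dist_real_def)
  finally show "dist (1 / f x) (1 / f y) \<le> 4 * K * dist x y" by simp
qed (use lipschitz_on_nonneg[OF assms(1)] in simp)

lemma sum_lipschitz:
  fixes f g :: "'a::metric_space \<Rightarrow> real"
  shows "\<exists>K. K-lipschitz_on S f \<Longrightarrow> \<exists>K. K-lipschitz_on S g \<Longrightarrow> \<exists>K. K-lipschitz_on S (\<lambda>x. f x + g x)"
    and "\<exists>K. K-lipschitz_on S f \<Longrightarrow> \<exists>K. K-lipschitz_on S g \<Longrightarrow> \<exists>K. K-lipschitz_on S (\<lambda>x. f x - g x)"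
    and "\<exists>K. K-lipschitz_on S f \<Longrightarrow> \<exists>K. K-lipschitz_on S (\<lambda>x. f x / 2)"
proof -
  show "\<exists>K. K-lipschitz_on S f \<Longrightarrow> \<exists>K. K-lipschitz_on S g \<Longrightarrow> \<exists>K. K-lipschitz_on S (\<lambda>x. f x + g x)"
    by (blast intro: lipschitz_on_add)
  show "\<exists>K. K-lipschitz_on S f \<Longrightarrow> \<exists>K. K-lipschitz_on S g \<Longrightarrow> \<exists>K. K-lipschitz_on S (\<lambda>x. f x - g x)"
    by (blast intro: lipschitz_on_diff)
  have "(\<bar>1 / 2\<bar> * K)-lipschitz_on S (\<lambda>x. f x / 2)" if "K-lipschitz_on S f" for K
    using lipschitz_on_cmult_real[OF that, of "1 / 2"] by simp
  then show "\<exists>K. K-lipschitz_on S f \<Longrightarrow> \<exists>K. K-lipschitz_on S (\<lambda>x. f x / 2)" by blast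
qed

lemma vector_4:
  "(vector [w, x, y, z] :: 'a::zero ^ 4) $ 1 = w" "(vector [w, x, y, z] :: 'a ^ 4) $ 2 = x"
  "(vector [w, x, y, z] :: 'a ^ 4) $ 3 = y" "(vector [w, x, y, z] :: 'a ^ 4) $ 4 = z"
  unfolding vector_def by simp_all

lemma dist_vector_4:
  fixes k l :: "real^3"
  shows "dist (vector [s, k$1, k$2, k$3] :: real^4) (vector [t, l$1, l$2, l$3]) =
    sqrt ((s - t)\<^sup>2 + (dist k l)\<^sup>2)"
  by (simp add: dist_vec_def L2_set_def vector_4 sum_4 sum_3 dist_real_def power2_abs
      real_sqrt_pow2 sum_nonneg add.assoc)

lemma norm_Pair_le: "norm (s, t) \<le> \<bar>s\<bar> + \<bar>t\<bar>" for s t :: real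
  using sqrt_sum_squares_le_sum_abs[of s t] by (simp add: norm_Pair)

text \<open>With 3/2 as a bound for \<open>sqrt 2\<close>, the graph distance \<open>e\<close> and
  the maximum \<open>m\<close> satisfy \<open>e \<le> (1 + 42 * 3 / 2) * m = 64 * m\<close> and
  \<open>m \<le> 13 * 3 / 2 * e \<le> 20 * e\<close>. The factors 2 and 4 between \<open>m\<close>
  and \<open>d\<close> turn these into 128 and 80, both below 200.\<close>

lemma snowflake_graph_comparison:
  fixes K :: "real \<Rightarrow> real^3" and k l :: "real^3"
  assumes k: "sqrt \<bar>\<delta>\<bar> / 13 \<le> dist k l" "dist k l \<le> 42 * sqrt \<bar>\<delta>\<bar>"
    and \<delta>: "\<bar>\<delta>\<bar> \<le> 2 * \<bar>\<tau>\<bar>" "\<bar>\<tau>\<bar> \<le> 2 * \<bar>\<delta>\<bar>"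
    and d: "max \<bar>\<sigma>\<bar> (sqrt \<bar>\<tau>\<bar>) / 2 \<le> d" "d \<le> 4 * max \<bar>\<sigma>\<bar> (sqrt \<bar>\<tau>\<bar>)"
  shows "d / 200 \<le> sqrt (\<sigma>\<^sup>2 + (dist k l)\<^sup>2)" and "sqrt (\<sigma>\<^sup>2 + (dist k l)\<^sup>2) \<le> 200 * d"
proof -
  define m where "m = max \<bar>\<sigma>\<bar> (sqrt \<bar>\<tau>\<bar>)"
  define e where "e = sqrt (\<sigma>\<^sup>2 + (dist k l)\<^sup>2)"
  have s2: "sqrt 2 \<le> 3 / 2" by (rule real_le_lsqrt) (auto simp: power2_eq_square)
  have r: "sqrt \<bar>\<delta>\<bar> \<le> 3 / 2 * sqrt \<bar>\<tau>\<bar>" "sqrt \<bar>\<tau>\<bar> \<le> 3 / 2 * sqrt \<bar>\<delta>\<bar>"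
    using real_sqrt_le_mono[OF \<delta>(1)] real_sqrt_le_mono[OF \<delta>(2)] mult_right_mono[OF s2, of "sqrt \<bar>\<tau>\<bar>"]
      mult_right_mono[OF s2, of "sqrt \<bar>\<delta>\<bar>"]
    by (simp_all add: real_sqrt_mult)
  have "\<bar>\<sigma>\<bar> \<le> e" unfolding e_def by (rule real_le_rsqrt) simp
  moreover have "dist k l \<le> e" unfolding e_def by (rule real_le_rsqrt) simp
  moreover have "e \<le> \<bar>\<sigma>\<bar> + dist k l"
    using sqrt_sum_squares_le_sum_abs[of \<sigma> "dist k l"] by (simp add: e_def)
  moreover have "\<bar>\<sigma>\<bar> \<le> m" "sqrt \<bar>\<tau>\<bar> \<le> m" by (auto simp: m_def)
  moreover have "m = \<bar>\<sigma>\<bar> \<or> m = sqrt \<bar>\<tau>\<bar>" by (auto simp: m_def)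
  moreover have "0 \<le> sqrt \<bar>\<tau>\<bar>" "0 \<le> \<bar>\<sigma>\<bar>" by auto
  ultimately have "m \<le> 20 * e" "e \<le> 64 * m" using k r by argo+
  then show "d / 200 \<le> sqrt (\<sigma>\<^sup>2 + (dist k l)\<^sup>2)" "sqrt (\<sigma>\<^sup>2 + (dist k l)\<^sup>2) \<le> 200 * d"
    using d \<open>0 \<le> \<bar>\<sigma>\<bar>\<close> \<open>\<bar>\<sigma>\<bar> \<le> m\<close> unfolding m_def[symmetric] e_def[symmetric] by argo+
qed

text \<open>The horizontal plane at the origin is \<open>z = 0\<close>. Hence \<open>(1, 0)\<close>
  is mapped to the horizontal tangent direction, with slope \<open>\<beta>\<close>, and
  \<open>(0, 1)\<close> to a transversal one. The number \<open>c\<close> is unbounded and may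
  influence only the size of the patch.\<close>

locale normal_patch =
  fixes \<Phi> :: "real \<times> real \<Rightarrow> real^3" and \<Phi>' :: "real \<times> real \<Rightarrow> real \<times> real \<Rightarrow> real^3" and R C \<beta> c :: real
  assumes R: "0 < R"
    and deriv: "norm w < R \<Longrightarrow> (\<Phi> has_derivative \<Phi>' w) (at w)"
    and deriv_lipschitz:
      "norm w < R \<Longrightarrow> norm w' < R \<Longrightarrow> norm (\<Phi>' w v - \<Phi>' w' v) \<le> C * norm (w - w') * norm v"
    and base: "\<Phi> 0 = 0"
    and deriv_0: "\<Phi>' 0 (s, t) = vector [s, \<beta> * s + c * t, t]"
    and slope: "\<bar>\<beta>\<bar> \<le> 1"
begin

text \<open>\<open>P ds + Q dt\<close> is the pullback of the contact form \<open>dz + (y dx - x dy) / 2\<close> under \<open>\<Phi>\<close>.\<close>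

definition form :: "real \<times> real \<Rightarrow> real \<times> real \<Rightarrow> real" where
  "form v w = \<Phi>' w v $ 3 + (\<Phi> w $ 2 * \<Phi>' w v $ 1 - \<Phi> w $ 1 * \<Phi>' w v $ 2) / 2"

text \<open>The vector \<open>(1, leaf_slope s t)\<close> spans the kernel of the pulled-back form,
  so leaves are graphs of solutions of the equation with this right-hand side.\<close>

definition leaf_slope :: "real \<Rightarrow> real \<Rightarrow> real" where
  "leaf_slope s t = - form (1, 0) (s, t) / form (0, 1) (s, t)"

definition N :: real where "N = \<bar>c\<bar> + 2"

text \<open>The third condition limits the variation of the derivative on the square, the fourth the
  horizontal coordinates of \<open>\<Phi>\<close>. The factor \<open>N\<close> in the threshold
  compensates for later products with the slope \<open>c\<close>.\<close>

definition tame :: "real \<Rightarrow> bool" where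
  "tame r \<longleftrightarrow> 0 < r \<and> 2 * r < R \<and> 2 * r * \<bar>C\<bar> \<le> 1 / (1200 * N) \<and> 4 * N * r \<le> 1 / (1200 * N)"

abbreviation square :: "real \<Rightarrow> (real \<times> real) set" where
  "square r \<equiv> {-r..r} \<times> {-r..r}"

lemma N_ge: "2 \<le> N" "\<bar>c\<bar> = N - 2" by (auto simp: N_def)

lemma tame_exists: "\<exists>r. tame r"
proof -
  define r where "r = min (R / 3) (1 / (1200 * N * (4 * N + 2 * \<bar>C\<bar>)))"
  have pos: "0 < 1200 * N * (4 * N + 2 * \<bar>C\<bar>)" using N_ge by simp
  have r: "0 < r" "r \<le> R / 3" using R pos unfolding r_def by auto
  have "r * (4 * N + 2 * \<bar>C\<bar>) \<le> 1 / (1200 * N * (4 * N + 2 * \<bar>C\<bar>)) * (4 * N + 2 * \<bar>C\<bar>)"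
    using N_ge by (intro mult_right_mono) (auto simp: r_def)
  also have "\<dots> = 1 / (1200 * N)" using N_ge by simp
  finally have "4 * N * r + 2 * r * \<bar>C\<bar> \<le> 1 / (1200 * N)" by (simp add: algebra_simps)
  moreover have "0 \<le> 4 * N * r" "0 \<le> 2 * r * \<bar>C\<bar>" using r N_ge by auto
  ultimately have "2 * r * \<bar>C\<bar> \<le> 1 / (1200 * N)" "4 * N * r \<le> 1 / (1200 * N)" by argo+
  then have "tame r" unfolding tame_def using r R by auto
  then show ?thesis ..
qed

lemma tame_smaller:
  assumes "tame r" "0 < r'" "r' \<le> r"
  shows "tame r'"
proof -
  have "2 * r' * \<bar>C\<bar> \<le> 2 * r * \<bar>C\<bar>" "4 * N * r' \<le> 4 * N * r"
    using assms N_ge by (auto intro!: mult_right_mono mult_left_mono)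
  then show ?thesis using assms unfolding tame_def by (meson order_trans mult_left_mono order.strict_trans1 zero_le_numeral)
qed

lemma norm_square: "w \<in> square r \<Longrightarrow> norm w \<le> 2 * r"
  using norm_Pair_le[of "fst w" "snd w"] by (cases w) auto

context
  fixes r assumes r: "tame r"
begin

lemma r_bounds: "0 < r" "r \<le> 1 / 10000" "N * r \<le> 1 / 9600" "N\<^sup>2 * r \<le> 1 / 4800"
proof -
  have b: "4 * N * r \<le> 1 / (1200 * N)" and r0: "0 < r" using r by (auto simp: tame_def)
  show "0 < r" by (rule r0)
  show "N\<^sup>2 * r \<le> 1 / 4800"
    using mult_left_mono[OF b, of N] N_ge by (simp add: power2_eq_square field_simps)
  have "1 / (1200 * N) \<le> 1 / 2400" using N_ge by (simp add: field_simps)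
  then show "N * r \<le> 1 / 9600" using b by argo
  then show "r \<le> 1 / 10000" using mult_right_mono[OF N_ge(1), of r] r0 by argo
qed

lemma in_domain: "w \<in> square r \<Longrightarrow> norm w < R"
  using norm_square[of w r] r by (auto simp: tame_def)

lemma deriv_close:
  assumes "w \<in> square r"
  shows "norm (\<Phi>' w v - \<Phi>' 0 v) \<le> 1 / (1200 * N) * norm v"
proof -
  have "norm (\<Phi>' w v - \<Phi>' 0 v) \<le> C * norm w * norm v"
    using deriv_lipschitz[of w 0 v] in_domain[OF assms] R by simp
  also have "C * norm w \<le> \<bar>C\<bar> * (2 * r)"
    using norm_square[OF assms] by (intro mult_mono) auto
  also have "\<dots> \<le> 1 / (1200 * N)" using r by (simp add: tame_def algebra_simps)
  finally show ?thesis by (simp add: mult_right_mono)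
qed

lemma linear_deriv: "w \<in> square r \<Longrightarrow> linear (\<Phi>' w)"
  using deriv[OF in_domain] has_derivative_linear by blast

lemma deriv_components:
  assumes "w \<in> square r"
  defines "\<epsilon> \<equiv> 1 / (1200 * N)"
  shows "\<bar>\<Phi>' w (1, 0) $ 1 - 1\<bar> \<le> \<epsilon>" "\<bar>\<Phi>' w (1, 0) $ 2 - \<beta>\<bar> \<le> \<epsilon>" "\<bar>\<Phi>' w (1, 0) $ 3\<bar> \<le> \<epsilon>"
    "\<bar>\<Phi>' w (0, 1) $ 1\<bar> \<le> \<epsilon>" "\<bar>\<Phi>' w (0, 1) $ 2 - c\<bar> \<le> \<epsilon>" "\<bar>\<Phi>' w (0, 1) $ 3 - 1\<bar> \<le> \<epsilon>"
proof -
  have "\<bar>(\<Phi>' w v - \<Phi>' 0 v) $ m\<bar> \<le> \<epsilon> * norm v" for v m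
    using component_le_norm_cart[of "\<Phi>' w v - \<Phi>' 0 v" m] deriv_close[OF assms(1), of v]
    unfolding \<epsilon>_def by simp
  from this[of "(1, 0)" 1] this[of "(1, 0)" 2] this[of "(1, 0)" 3]
    this[of "(0, 1)" 1] this[of "(0, 1)" 2] this[of "(0, 1)" 3]
  show "\<bar>\<Phi>' w (1, 0) $ 1 - 1\<bar> \<le> \<epsilon>" "\<bar>\<Phi>' w (1, 0) $ 2 - \<beta>\<bar> \<le> \<epsilon>" "\<bar>\<Phi>' w (1, 0) $ 3\<bar> \<le> \<epsilon>"
    "\<bar>\<Phi>' w (0, 1) $ 1\<bar> \<le> \<epsilon>" "\<bar>\<Phi>' w (0, 1) $ 2 - c\<bar> \<le> \<epsilon>" "\<bar>\<Phi>' w (0, 1) $ 3 - 1\<bar> \<le> \<epsilon>"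
    by (simp_all add: deriv_0)
qed

lemma linearization:
  assumes "w \<in> square r" "w' \<in> square r"
  shows "norm (\<Phi> w - \<Phi> w' - \<Phi>' 0 (w - w')) \<le> 1 / (1200 * N) * norm (w - w')"
proof -
  have lin: "bounded_linear (\<Phi>' 0)" using deriv[of 0] R has_derivative_bounded_linear by auto
  have "norm ((\<Phi> w - \<Phi>' 0 w) - (\<Phi> w' - \<Phi>' 0 w')) \<le> 1 / (1200 * N) * norm (w - w')"
  proof (rule differentiable_bound[where S = "square r"])
    show "convex (square r)" by (intro convex_Times convex_real_interval)
    show "((\<lambda>w. \<Phi> w - \<Phi>' 0 w) has_derivative (\<lambda>v. \<Phi>' x v - \<Phi>' 0 v)) (at x within square r)"
      if "x \<in> square r" for x
      by (rule has_derivative_diff[OF has_derivative_at_withinI[OF deriv[OF in_domain[OF that]]]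
            bounded_linear_imp_has_derivative[OF lin]])
    show "onorm (\<lambda>v. \<Phi>' x v - \<Phi>' 0 v) \<le> 1 / (1200 * N)" if "x \<in> square r" for x
      by (rule onorm_bound) (use deriv_close[OF that] N_ge in auto)
  qed (use assms in auto)
  moreover have "\<Phi>' 0 (w - w') = \<Phi>' 0 w - \<Phi>' 0 w'"
    using lin by (simp add: bounded_linear.linear linear_diff)
  then have "\<Phi> w - \<Phi> w' - \<Phi>' 0 (w - w') = (\<Phi> w - \<Phi>' 0 w) - (\<Phi> w' - \<Phi>' 0 w')" by simp
  ultimately show ?thesis by (simp only:)
qed

lemma zero_in_square: "0 \<in> square r"
  using r_bounds by (simp add: zero_prod_def)

lemma components_small:
  assumes "w \<in> square r"
  shows "\<bar>\<Phi> w $ 1\<bar> \<le> 1 / (1200 * N)" "\<bar>\<Phi> w $ 2\<bar> \<le> 1 / (1200 * N)"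
proof -
  obtain s t where w: "w = (s, t)" by (cases w)
  have st: "\<bar>s\<bar> \<le> r" "\<bar>t\<bar> \<le> r" using assms unfolding w by auto
  have b: "norm (\<Phi> w - \<Phi>' 0 w) \<le> 1 / (1200 * N) * norm w"
    using linearization[OF assms zero_in_square] by (simp add: base)
  also have "\<dots> \<le> 1 * (2 * r)"
    using norm_square[OF assms] N_ge by (intro mult_mono) (auto simp: field_simps)
  finally have n: "\<bar>(\<Phi> w - \<Phi>' 0 w) $ m\<bar> \<le> 2 * r" for m
    using component_le_norm_cart[of "\<Phi> w - \<Phi>' 0 w" m] by simp
  have "\<bar>\<Phi> w $ 1 - s\<bar> \<le> 2 * r" "\<bar>\<Phi> w $ 2 - (\<beta> * s + c * t)\<bar> \<le> 2 * r"
    using n[of 1] n[of 2] by (simp_all add: w deriv_0)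
  moreover have "\<bar>\<beta> * s\<bar> \<le> 1 * r" "\<bar>c * t\<bar> \<le> (N - 2) * r"
    using st slope N_ge by (intro abs_prod_le; simp)+
  moreover have "2 * r \<le> N * r" using N_ge r_bounds by (intro mult_right_mono) auto
  ultimately have "\<bar>\<Phi> w $ 1\<bar> \<le> 4 * (N * r)" "\<bar>\<Phi> w $ 2\<bar> \<le> 4 * (N * r)"
    using st unfolding left_diff_distrib by argo+
  then show "\<bar>\<Phi> w $ 1\<bar> \<le> 1 / (1200 * N)" "\<bar>\<Phi> w $ 2\<bar> \<le> 1 / (1200 * N)"
    using r by (auto simp: tame_def)
qed

text \<open>At the origin the pulled-back form is \<open>dt\<close>, with coefficients 0 and 1. On a
  tame square both coefficients stay close to these values.\<close>

lemma form_bounds: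
  assumes w: "w \<in> square r"
  shows "\<bar>form (1, 0) w\<bar> \<le> 1 / (400 * N)" and "1 / 2 \<le> form (0, 1) w"
proof -
  define \<epsilon> where "\<epsilon> = 1 / (1200 * N)"
  have \<epsilon>: "0 < \<epsilon>" "\<epsilon> \<le> 1 / 2400" "N * \<epsilon> = 1 / 1200" "1 / (400 * N) = 3 * \<epsilon>"
    using N_ge by (auto simp: \<epsilon>_def field_simps)
  note D = deriv_components[OF w, folded \<epsilon>_def] and S = components_small[OF w, folded \<epsilon>_def]
  have "\<bar>\<Phi> w $ 2 * \<Phi>' w (1, 0) $ 1\<bar> \<le> \<epsilon> * 2"
  proof (rule abs_prod_le[OF S(2)])
    show "\<bar>\<Phi>' w (1, 0) $ 1\<bar> \<le> 2" using D(1) \<epsilon> by argo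
  qed
  moreover have "\<bar>\<Phi> w $ 1 * \<Phi>' w (1, 0) $ 2\<bar> \<le> \<epsilon> * 2"
  proof (rule abs_prod_le[OF S(1)])
    show "\<bar>\<Phi>' w (1, 0) $ 2\<bar> \<le> 2" using D(2) slope \<epsilon> by argo
  qed
  ultimately show "\<bar>form (1, 0) w\<bar> \<le> 1 / (400 * N)"
    using D(3) unfolding form_def \<epsilon>(4) by argo
  have "\<bar>\<Phi> w $ 2 * \<Phi>' w (0, 1) $ 1\<bar> \<le> \<epsilon> * 1"
  proof (rule abs_prod_le[OF S(2)])
    show "\<bar>\<Phi>' w (0, 1) $ 1\<bar> \<le> 1" using D(4) \<epsilon> by argo
  qed
  moreover have "\<bar>\<Phi> w $ 1 * \<Phi>' w (0, 1) $ 2\<bar> \<le> \<epsilon> * N"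
  proof (rule abs_prod_le[OF S(1)])
    show "\<bar>\<Phi>' w (0, 1) $ 2\<bar> \<le> N" using D(5) N_ge \<epsilon> by argo
  qed
  then have "\<bar>\<Phi> w $ 1 * \<Phi>' w (0, 1) $ 2\<bar> \<le> 1 / 1200" using \<epsilon>(3) by (simp add: mult.commute)
  ultimately show "1 / 2 \<le> form (0, 1) w"
    using D(6) \<epsilon> unfolding form_def by argo
qed

lemma leaf_slope_bound:
  assumes "(s, t) \<in> square r"
  shows "\<bar>leaf_slope s t\<bar> \<le> 1 / (200 * N)"
proof -
  have "\<bar>leaf_slope s t\<bar> = \<bar>form (1, 0) (s, t)\<bar> / form (0, 1) (s, t)"
    using form_bounds(2)[OF assms] by (simp add: leaf_slope_def abs_divide)
  also have "\<dots> \<le> (1 / (400 * N)) / (1 / 2)"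
    using form_bounds[OF assms] N_ge by (intro frac_le) auto
  finally show ?thesis by simp
qed

text \<open>Here the Lipschitz condition on the derivative enters: both coefficients of the form are
  built from components of \<open>\<Phi>\<close> and \<open>\<Phi>'\<close> by sums and products,
  and the denominator is bounded away from 0.\<close>

lemma leaf_slope_lipschitz: "\<exists>K. K-lipschitz_on (square r) (\<lambda>(s, t). leaf_slope s t)"
proof -
  have compact: "compact (square r)" by (intro compact_Times compact_Icc)
  have D: "\<exists>K. K-lipschitz_on (square r) (\<lambda>w. \<Phi>' w v $ m)" for v m
  proof -
    have "(\<bar>C\<bar> * norm v)-lipschitz_on (square r) (\<lambda>w. \<Phi>' w v $ m)"
    proof (rule lipschitz_onI)
      fix w w' assume "w \<in> square r" "w' \<in> square r"
      then have "norm (\<Phi>' w v - \<Phi>' w' v) \<le> C * norm (w - w') * norm v"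
        by (intro deriv_lipschitz in_domain)
      also have "\<dots> \<le> \<bar>C\<bar> * norm (w - w') * norm v" by (intro mult_right_mono) auto
      finally show "dist (\<Phi>' w v $ m) (\<Phi>' w' v $ m) \<le> \<bar>C\<bar> * norm v * dist w w'"
        using component_le_norm_cart[of "\<Phi>' w v - \<Phi>' w' v" m]
        by (simp add: dist_real_def dist_norm mult.commute mult.left_commute)
    qed auto
    then show ?thesis by blast
  qed
  have F: "\<exists>K. K-lipschitz_on (square r) (\<lambda>w. \<Phi> w $ m)" for m
  proof -
    have lin: "bounded_linear (\<Phi>' 0)" using deriv[of 0] R has_derivative_bounded_linear by auto
    then obtain B where B: "\<And>v. norm (\<Phi>' 0 v) \<le> norm v * B" "0 \<le> B"
      using bounded_linear.nonneg_bounded by blast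
    have "(1 + B)-lipschitz_on (square r) (\<lambda>w. \<Phi> w $ m)"
    proof (rule lipschitz_onI)
      fix w w' assume w: "w \<in> square r" "w' \<in> square r"
      have "norm (\<Phi> w - \<Phi> w') \<le> norm (\<Phi> w - \<Phi> w' - \<Phi>' 0 (w - w')) + norm (\<Phi>' 0 (w - w'))"
        using norm_triangle_ineq[of "\<Phi> w - \<Phi> w' - \<Phi>' 0 (w - w')" "\<Phi>' 0 (w - w')"] by simp
      also have "\<dots> \<le> 1 / (1200 * N) * norm (w - w') + norm (w - w') * B"
        by (intro add_mono linearization w B)
      also have "1 / (1200 * N) * norm (w - w') \<le> 1 * norm (w - w')"
        using N_ge by (intro mult_right_mono) (auto simp: field_simps)
      finally show "dist (\<Phi> w $ m) (\<Phi> w' $ m) \<le> (1 + B) * dist w w'"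
        using component_le_norm_cart[of "\<Phi> w - \<Phi> w'" m]
        by (simp add: dist_real_def dist_norm algebra_simps)
    qed (use B in auto)
    then show ?thesis by blast
  qed
  have form: "\<exists>K. K-lipschitz_on (square r) (form v)" for v
    unfolding form_def by (intro sum_lipschitz product_lipschitz compact D F)
  obtain K1 where "K1-lipschitz_on (square r) (form (0, 1))" using form by blast
  then have "\<exists>K. K-lipschitz_on (square r) (\<lambda>w. 1 / form (0, 1) w)"
    using inverse_lipschitz form_bounds(2) by blast
  then obtain K where "K-lipschitz_on (square r) (\<lambda>w. form (1, 0) w * (1 / form (0, 1) w))"
    using product_lipschitz[OF compact form] by blast
  then have "K-lipschitz_on (square r) (\<lambda>w. - (form (1, 0) w * (1 / form (0, 1) w)))" by simp
  moreover have "(\<lambda>w. - (form (1, 0) w * (1 / form (0, 1) w))) = (\<lambda>(s, t). leaf_slope s t)"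
    by (auto simp: leaf_slope_def)
  ultimately show ?thesis by metis
qed

lemma leaf_curve:
  assumes u: "\<And>s. s \<in> {-r..r} \<Longrightarrow> u s \<in> {-r..r}"
    "\<And>s. s \<in> {-r..r} \<Longrightarrow> (u has_real_derivative leaf_slope s (u s)) (at s within {-r..r})"
    and s: "s \<in> {-r..r}" "s' \<in> {-r..r}"
  defines "g \<equiv> \<lambda>s. \<Phi> (s, u s)"
  shows "\<bar>g s $ 1 - g s' $ 1 - (s - s')\<bar> \<le> \<bar>s - s'\<bar> / 100"
    and "\<bar>g s $ 2 - g s' $ 2\<bar> \<le> 2 * \<bar>s - s'\<bar>"
    and "\<bar>twist (g s) (g s')\<bar> \<le> (s - s')\<^sup>2 / 20"
proof -
  define g' where "g' m s = \<Phi>' (s, u s) (1, 0) $ m + leaf_slope s (u s) * \<Phi>' (s, u s) (0, 1) $ m" for m s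
  have sq: "(s, u s) \<in> square r" if "s \<in> {-r..r}" for s using u that by auto
  have d: "((\<lambda>s. g s $ m) has_real_derivative g' m s) (at s within {-r..r})" if s: "s \<in> {-r..r}" for m s
  proof -
    let ?h = "leaf_slope s (u s)"
    have "((\<lambda>s. (s, u s)) has_derivative (\<lambda>x. (x, ?h * x))) (at s within {-r..r})"
      using u(2)[OF s] by (intro has_derivative_Pair has_derivative_ident) (simp add: has_field_derivative_def)
    moreover have "(\<Phi> has_derivative \<Phi>' (s, u s)) (at (s, u s))"
      by (rule deriv[OF in_domain[OF sq[OF s]]])
    ultimately have "((\<lambda>s. \<Phi> (s, u s)) has_derivative (\<lambda>x. \<Phi>' (s, u s) (x, ?h * x))) (at s within {-r..r})"
      by (rule has_derivative_compose)
    then have "((\<lambda>s. g s $ m) has_derivative (\<lambda>x. \<Phi>' (s, u s) (x, ?h * x) $ m)) (at s within {-r..r})"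
      unfolding g_def by (rule bounded_linear.has_derivative[OF bounded_linear_vec_nth])
    moreover have "\<Phi>' (s, u s) (x, ?h * x) $ m = g' m s * x" for x
    proof -
      note lin = linear_deriv[OF sq[OF s]]
      have eq: "(x, ?h * x) = x *\<^sub>R (1, 0) + (?h * x) *\<^sub>R (0, 1)" by simp
      have "\<Phi>' (s, u s) (x, ?h * x) = x *\<^sub>R \<Phi>' (s, u s) (1, 0) + (?h * x) *\<^sub>R \<Phi>' (s, u s) (0, 1)"
        unfolding eq by (simp only: linear_add[OF lin] linear_scale[OF lin])
      then show ?thesis by (simp add: g'_def algebra_simps)
    qed
    ultimately show ?thesis by (simp add: has_field_derivative_def)
  qed
  have small: "\<bar>leaf_slope s (u s)\<bar> \<le> 1 / (200 * N)" if "s \<in> {-r..r}" for s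
    using leaf_slope_bound[OF sq[OF that]] .
  define \<epsilon> where "\<epsilon> = 1 / (1200 * N)"
  have \<epsilon>: "0 < \<epsilon>" "\<epsilon> \<le> 1 / 2400" using N_ge by (auto simp: \<epsilon>_def field_simps)
  have N1: "1 / (200 * N) \<le> 1 / 400" "1 / (200 * N) * N = 1 / 200" using N_ge by (auto simp: field_simps)
  have b1: "\<bar>g' 1 s - 1\<bar> \<le> 1 / 100" if s: "s \<in> {-r..r}" for s
  proof -
    have "\<bar>leaf_slope s (u s) * \<Phi>' (s, u s) (0, 1) $ 1\<bar> \<le> 1 / (200 * N) * 1"
      by (rule abs_prod_le[OF small[OF s]])
        (use deriv_components(4)[OF sq[OF s], folded \<epsilon>_def] \<epsilon> in argo)
    then show ?thesis
      using deriv_components(1)[OF sq[OF s], folded \<epsilon>_def] \<epsilon> N1(1) unfolding g'_def by argo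
  qed
  \<comment> \<open>The \<open>N\<close> in the denominator of the slope bound cancels the size of
    the transversal velocity.\<close>
  have b2: "\<bar>g' 2 s - \<beta>\<bar> \<le> 1 / 100" if s: "s \<in> {-r..r}" for s
  proof -
    have "\<bar>leaf_slope s (u s) * \<Phi>' (s, u s) (0, 1) $ 2\<bar> \<le> 1 / (200 * N) * N"
      by (rule abs_prod_le[OF small[OF s]])
        (use deriv_components(5)[OF sq[OF s], folded \<epsilon>_def] \<epsilon> N_ge in argo)
    then show ?thesis
      using deriv_components(2)[OF sq[OF s], folded \<epsilon>_def] \<epsilon> unfolding N1(2) g'_def by argo
  qed
  have horizontal: "g' 3 s = (g s $ 1 * g' 2 s - g s $ 2 * g' 1 s) / 2" if s: "s \<in> {-r..r}" for s
  proof -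
    define h p q where "h = leaf_slope s (u s)" and "p = form (1, 0) (s, u s)" and "q = form (0, 1) (s, u s)"
    have "q \<noteq> 0" using form_bounds(2)[OF sq[OF s]] unfolding q_def by auto
    \<comment> \<open>This states that the leaf direction lies in the kernel of the pulled-back
      form; written out in components it is horizontality.\<close>
    then have "p + h * q = 0" by (simp add: h_def p_def q_def leaf_slope_def)
    then show ?thesis
      unfolding p_def q_def form_def g'_def g_def h_def[symmetric] by (simp add: field_simps)
  qed
  show "\<bar>g s $ 1 - g s' $ 1 - (s - s')\<bar> \<le> \<bar>s - s'\<bar> / 100"
    "\<bar>g s $ 2 - g s' $ 2\<bar> \<le> 2 * \<bar>s - s'\<bar>" "\<bar>twist (g s) (g s')\<bar> \<le> (s - s')\<^sup>2 / 20"
    using horizontal_curve_twist[where g = g and x' = "g' 1" and y' = "g' 2" and z' = "g' 3",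
      OF d d d horizontal b1 b2 slope s] by auto
qed

text \<open>\<open>u\<close> describes the leaf through the second point. The intermediate point is
  \<open>\<Phi> (s, u s)\<close>, where this leaf meets the transversal through the first point, so
  that \<open>\<sigma> = s - s'\<close> and \<open>\<tau> = t - u s\<close>.\<close>

lemma koranyi_on_patch:
  assumes a: "(s, t) \<in> square (r / 2)" and b: "(s', u s') \<in> square (r / 2)"
    and u: "\<And>s. s \<in> {-r..r} \<Longrightarrow> u s \<in> {-r..r}"
    "\<And>s. s \<in> {-r..r} \<Longrightarrow> (u has_real_derivative leaf_slope s (u s)) (at s within {-r..r})"
  shows "max \<bar>s - s'\<bar> (sqrt \<bar>t - u s\<bar>) / 2 \<le> koranyi (\<Phi> (s, t)) (\<Phi> (s', u s'))"
    and "koranyi (\<Phi> (s, t)) (\<Phi> (s', u s')) \<le> 4 * max \<bar>s - s'\<bar> (sqrt \<bar>t - u s\<bar>)"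
proof -
  have s: "s \<in> {-r..r}" "s' \<in> {-r..r}" and t: "t \<in> {-r..r}" using a b r_bounds by auto
  have st: "(s, t) \<in> square r" "(s, u s) \<in> square r" using s t u by auto
  define \<tau> where "\<tau> = t - u s"
  define \<epsilon> where "\<epsilon> = 1 / (1200 * N)"
  have \<epsilon>: "0 < \<epsilon>" "\<epsilon> \<le> 1 / 2400" "N * \<epsilon> = 1 / 1200" using N_ge by (auto simp: \<epsilon>_def field_simps)
  have "norm (\<Phi> (s, t) - \<Phi> (s, u s) - \<Phi>' 0 (0, \<tau>)) \<le> \<epsilon> * \<bar>\<tau>\<bar>"
    using linearization[OF st] by (simp add: \<tau>_def \<epsilon>_def)
  then have lin: "\<bar>(\<Phi> (s, t) - \<Phi> (s, u s) - \<Phi>' 0 (0, \<tau>)) $ m\<bar> \<le> \<epsilon> * \<bar>\<tau>\<bar>" for m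
    using component_le_norm_cart order_trans by blast
  have \<epsilon>\<tau>: "\<epsilon> * \<bar>\<tau>\<bar> \<le> 1 / 2400 * \<bar>\<tau>\<bar>" using \<epsilon> by (intro mult_right_mono) auto
  have x: "\<bar>\<Phi> (s, t) $ 1 - \<Phi> (s, u s) $ 1\<bar> \<le> \<bar>\<tau>\<bar> / 100"
  proof -
    have "\<bar>\<Phi> (s, t) $ 1 - \<Phi> (s, u s) $ 1\<bar> \<le> \<epsilon> * \<bar>\<tau>\<bar>"
      using lin[of 1] by (simp add: deriv_0)
    then show ?thesis using \<epsilon>\<tau> by argo
  qed
  have z: "\<bar>\<Phi> (s, t) $ 3 - \<Phi> (s, u s) $ 3 - \<tau>\<bar> \<le> \<bar>\<tau>\<bar> / 100"
  proof -
    have "\<bar>\<Phi> (s, t) $ 3 - \<Phi> (s, u s) $ 3 - \<tau>\<bar> \<le> \<epsilon> * \<bar>\<tau>\<bar>"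
      using lin[of 3] by (simp add: deriv_0)
    then show ?thesis using \<epsilon>\<tau> by argo
  qed
  have y: "\<bar>\<Phi> (s, t) $ 2 - \<Phi> (s, u s) $ 2\<bar> \<le> N * \<bar>\<tau>\<bar>"
  proof -
    have "\<bar>\<Phi> (s, t) $ 2 - \<Phi> (s, u s) $ 2 - c * \<tau>\<bar> \<le> \<epsilon> * \<bar>\<tau>\<bar>"
      using lin[of 2] by (simp add: deriv_0)
    moreover have "\<bar>c * \<tau>\<bar> = (N - 2) * \<bar>\<tau>\<bar>" by (simp add: abs_mult N_ge)
    ultimately show ?thesis using \<epsilon>\<tau> unfolding left_diff_distrib by argo
  qed
  have "N * \<bar>\<Phi> (s, u s) $ 1\<bar> \<le> N * \<epsilon>"
    using components_small(1)[OF st(2), folded \<epsilon>_def] N_ge by (intro mult_left_mono) auto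
  then have small1: "N * \<bar>\<Phi> (s, u s) $ 1\<bar> \<le> 1 / 100" using \<epsilon> by argo
  have small2: "\<bar>\<Phi> (s, u s) $ 2\<bar> \<le> 1"
    using components_small(2)[OF st(2), folded \<epsilon>_def] \<epsilon> by argo
  have "N * \<bar>s - s'\<bar> \<le> N * r" using a b N_ge by (intro mult_left_mono) auto
  then have small3: "N * \<bar>s - s'\<bar> \<le> 1 / 100" using r_bounds by argo
  have "N\<^sup>2 * \<bar>\<tau>\<bar> \<le> N\<^sup>2 * (2 * r)"
    using t u(1)[OF s(1)] unfolding \<tau>_def by (intro mult_left_mono) auto
  then have small4: "N\<^sup>2 * \<bar>\<tau>\<bar> \<le> 1 / 16" using r_bounds(4) by argo
  show "max \<bar>s - s'\<bar> (sqrt \<bar>t - u s\<bar>) / 2 \<le> koranyi (\<Phi> (s, t)) (\<Phi> (s', u s'))"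
    "koranyi (\<Phi> (s, t)) (\<Phi> (s', u s')) \<le> 4 * max \<bar>s - s'\<bar> (sqrt \<bar>t - u s\<bar>)"
    using koranyi_via_leaf_point[OF x y z leaf_curve[OF u s] small1 small2 small3 small4] N_ge
    unfolding \<tau>_def by auto
qed

end

text \<open>The first integral is the height \<open>u w 0\<close> at which the leaf through
  \<open>w\<close> crosses \<open>s = 0\<close>. A leaf is chosen for each point separately;
  \<open>ode_solution_comparison\<close> forces the heights of two points on a common leaf to
  agree.\<close>

lemma patch_embedding:
  fixes K :: "real \<Rightarrow> real^3"
  assumes K: "snowflake_map K"
  obtains F :: "real \<times> real \<Rightarrow> real^4" and \<rho> where "0 < \<rho>"
    "\<And>a b. norm a < \<rho> \<Longrightarrow> norm b < \<rho> \<Longrightarrow> koranyi (\<Phi> a) (\<Phi> b) / 200 \<le> dist (F a) (F b)"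
    "\<And>a b. norm a < \<rho> \<Longrightarrow> norm b < \<rho> \<Longrightarrow> dist (F a) (F b) \<le> 200 * koranyi (\<Phi> a) (\<Phi> b)"
proof -
  obtain r0 where r0: "tame r0" using tame_exists ..
  obtain L where L: "L-lipschitz_on (square r0) (\<lambda>(s, t). leaf_slope s t)"
    using leaf_slope_lipschitz[OF r0] ..
  \<comment> \<open>Shrinking by the Lipschitz constant of the slope gives
    \<open>r * L \<le> 1 / 4\<close>, the condition of both results on the differential
    equation.\<close>
  define r where "r = min r0 (1 / (4 * (L + 1)))"
  have L0: "0 \<le> L" using lipschitz_on_nonneg[OF L] .
  have r0_pos: "0 < r0" using r0 by (simp add: tame_def)
  have r: "tame r" "0 < r" "r \<le> r0"
    using tame_smaller[OF r0, of r] r0_pos L0 by (auto simp: r_def)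
  have "r * L \<le> 1 / (4 * (L + 1)) * (L + 1)"
    using L0 by (intro mult_mono) (auto simp: r_def)
  also have "\<dots> = 1 / 4" using L0 by (simp add: divide_simps)
  finally have rL: "r * L \<le> 1 / 4" .
  have L: "L-lipschitz_on (square r) (\<lambda>(s, t). leaf_slope s t)"
    by (rule lipschitz_on_subset[OF L]) (use r in auto)
  have lip: "\<bar>leaf_slope s t - leaf_slope s t'\<bar> \<le> L * \<bar>t - t'\<bar>"
    if "s \<in> {-r..r}" "t \<in> {-r..r}" "t' \<in> {-r..r}" for s t t'
    using lipschitz_onD[OF L, of "(s, t)" "(s, t')"] that by (simp add: dist_Pair_Pair dist_real_def)
  have bound: "\<bar>leaf_slope s t\<bar> \<le> 1 / 4" if "s \<in> {-r..r}" "t \<in> {-r..r}" for s t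
  proof -
    have "1 / (200 * N) \<le> 1 / 4" using N_ge by (simp add: field_simps)
    then show ?thesis using leaf_slope_bound[OF r(1), of s t] that by simp
  qed
  have "\<exists>u. u (fst w) = snd w \<and> (\<forall>s\<in>{-r..r}. u s \<in> {-r..r} \<and>
      (u has_real_derivative leaf_slope s (u s)) (at s within {-r..r}))" if "w \<in> square (r / 2)" for w
  proof -
    have "fst w \<in> {-r..r}" "\<bar>snd w\<bar> \<le> r / 2" using that r by auto
    show ?thesis
    proof (rule ode_solution_exists[where h = leaf_slope and K = L and p = "fst w" and q = "snd w" and r = r])
      show "continuous_on (square r) (\<lambda>(s, t). leaf_slope s t)"
        by (rule lipschitz_on_continuous_on[OF L])
      show "\<bar>leaf_slope s t - leaf_slope s t'\<bar> \<le> L * \<bar>t - t'\<bar>"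
        if "s \<in> {-r..r}" "t \<in> {-r..r}" "t' \<in> {-r..r}" for s t t'
        by (rule lip[OF that])
      show "\<bar>leaf_slope s t\<bar> \<le> 1 / 4" if "s \<in> {-r..r}" "t \<in> {-r..r}" for s t
        by (rule bound[OF that])
    qed (use r(2) L0 rL \<open>fst w \<in> {-r..r}\<close> \<open>\<bar>snd w\<bar> \<le> r / 2\<close> in blast)+
  qed
  then obtain u where u: "\<And>w. w \<in> square (r / 2) \<Longrightarrow> u w (fst w) = snd w"
    "\<And>w s. w \<in> square (r / 2) \<Longrightarrow> s \<in> {-r..r} \<Longrightarrow> u w s \<in> {-r..r}"
    "\<And>w s. w \<in> square (r / 2) \<Longrightarrow> s \<in> {-r..r} \<Longrightarrow>
        (u w has_real_derivative leaf_slope s (u w s)) (at s within {-r..r})"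
    by metis
  define F :: "real \<times> real \<Rightarrow> real^4"
    where "F w = vector [fst w, K (u w 0) $ 1, K (u w 0) $ 2, K (u w 0) $ 3]" for w
  have main: "koranyi (\<Phi> a) (\<Phi> b) / 200 \<le> dist (F a) (F b) \<and> dist (F a) (F b) \<le> 200 * koranyi (\<Phi> a) (\<Phi> b)"
    if a: "a \<in> square (r / 2)" and b: "b \<in> square (r / 2)" for a b
  proof -
    obtain s t s' t' where ab: "a = (s, t)" "b = (s', t')" by (cases a; cases b)
    have s: "s \<in> {-r..r}" "0 \<in> {-r..r}" using a r by (auto simp: ab)
    have t': "u b s' = t'" and t: "u a s = t" using u(1)[OF b] u(1)[OF a] by (auto simp: ab)
    have cmp: "\<bar>u a x - u b x\<bar> \<le> 2 * \<bar>u a y - u b y\<bar>" if "x \<in> {-r..r}" "y \<in> {-r..r}" for x y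
      by (rule ode_solution_comparison[OF u(3)[OF a] u(3)[OF b] _ lip L0 rL that])
        (use u(2) a b in auto)
    \<comment> \<open>The gap of the two leaves at 0, which \<open>K\<close> sees, is comparable
      with their gap at \<open>s\<close>, which the metric sees.\<close>
    have \<delta>: "\<bar>u a 0 - u b 0\<bar> \<le> 2 * \<bar>t - u b s\<bar>" "\<bar>t - u b s\<bar> \<le> 2 * \<bar>u a 0 - u b 0\<bar>"
      using cmp[of 0 s] cmp[of s 0] s t by auto
    have "\<bar>u a 0 - u b 0\<bar> \<le> 2 * r" using u(2)[OF a s(2)] u(2)[OF b s(2)] by auto
    then have "\<bar>u a 0 - u b 0\<bar> \<le> 1" using r_bounds(2)[OF r(1)] by argo
    then have snow: "sqrt \<bar>u a 0 - u b 0\<bar> / 13 \<le> dist (K (u a 0)) (K (u b 0))"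
      "dist (K (u a 0)) (K (u b 0)) \<le> 42 * sqrt \<bar>u a 0 - u b 0\<bar>"
      using K unfolding snowflake_map_def by blast+
    have d: "max \<bar>s - s'\<bar> (sqrt \<bar>t - u b s\<bar>) / 2 \<le> koranyi (\<Phi> a) (\<Phi> b)"
      "koranyi (\<Phi> a) (\<Phi> b) \<le> 4 * max \<bar>s - s'\<bar> (sqrt \<bar>t - u b s\<bar>)"
      using koranyi_on_patch[OF r(1), of s t s' "u b"] a b u(2,3)[OF b] unfolding ab t'[unfolded ab] by auto
    have "dist (F a) (F b) = sqrt ((s - s')\<^sup>2 + (dist (K (u a 0)) (K (u b 0)))\<^sup>2)"
      unfolding F_def dist_vector_4 by (simp add: ab)
    then show ?thesis using snowflake_graph_comparison[OF snow \<delta> d] by simp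
  qed
  have sq: "a \<in> square (r / 2)" if "norm a < r / 2" for a
    using that norm_fst_le[of "fst a" "snd a"] norm_snd_le[of "snd a" "fst a"] by (cases a) auto
  show ?thesis
    using that[of "r / 2" F] main sq r(2) by simp
qed

end

section \<open>Curves and surfaces\<close>

text \<open>The contact form at \<open>p\<close>. As \<open>contact p (a - p) = twist a p\<close>,
  it is also the vertical coordinate of the left translation that moves \<open>p\<close> to the
  origin; so that translation is linear in \<open>a - p\<close>.\<close>

definition contact :: "real^3 \<Rightarrow> real^3 \<Rightarrow> real" where
  "contact p v = v$3 + (v$1 * p$2 - p$1 * v$2) / 2"

lemma contact_zero_horizontal:
  assumes "contact p v = 0"
  shows "v \<in> horizontal_plane p"
proof -
  define e f :: "real^3" where "e = vector [1, 0, - (p$2) / 2]" and "f = vector [0, 1, (p$1) / 2]"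
  have "v = v$1 *\<^sub>R e + v$2 *\<^sub>R f"
    using assms by (simp add: vec_eq_iff forall_3 e_def f_def contact_def field_simps)
  moreover have "v$1 *\<^sub>R e + v$2 *\<^sub>R f \<in> span {e, f}"
    by (intro span_add span_scale span_base) auto
  ultimately show ?thesis unfolding horizontal_plane_def e_def f_def by metis
qed

text \<open>Left translation by \<open>p\<inverse>\<close>, followed if necessary by the isometry \<open>(x, y, z) \<mapsto> (y, x, - z)\<close>.\<close>

lemma koranyi_frame:
  fixes p u :: "real^3"
  obtains A :: "real^3 \<Rightarrow> real^3"
    where "linear A" "\<And>v. A v = 0 \<Longrightarrow> v = 0"
      "\<And>a b. koranyi (A (a - p)) (A (b - p)) = koranyi a b"
      "\<And>v. A v $ 3 = 0 \<longleftrightarrow> contact p v = 0"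
      "\<bar>A u $ 2\<bar> \<le> \<bar>A u $ 1\<bar>"
proof (cases "\<bar>u$2\<bar> \<le> \<bar>u$1\<bar>")
  case True
  define A :: "real^3 \<Rightarrow> real^3" where "A v = vector [v$1, v$2, contact p v]" for v
  have twist: "twist (A (a - p)) (A (b - p)) = twist a b" for a b
    by (simp add: A_def twist_def contact_def field_simps)
  show ?thesis
  proof
    show "linear A"
      by (rule linearI) (simp_all add: A_def contact_def vec_eq_iff forall_3 field_simps)
    show "v = 0" if "A v = 0" for v
      using that by (auto simp: A_def contact_def vec_eq_iff forall_3)
    show "koranyi (A (a - p)) (A (b - p)) = koranyi a b" for a b
      unfolding koranyi_twist twist by (simp add: A_def)
  qed (use True in \<open>simp_all add: A_def\<close>)
next
  \<comment> \<open>Exchanging the horizontal coordinates reverses the sign of the twist, hence the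
    sign in the third entry. The exchange is what later yields
    \<open>\<bar>\<beta>\<bar> \<le> 1\<close>.\<close>
  case False
  define A :: "real^3 \<Rightarrow> real^3" where "A v = vector [v$2, v$1, - contact p v]" for v
  have twist: "twist (A (a - p)) (A (b - p)) = - twist a b" for a b
    by (simp add: A_def twist_def contact_def field_simps)
  show ?thesis
  proof
    show "linear A"
      by (rule linearI) (simp_all add: A_def contact_def vec_eq_iff forall_3 field_simps)
    show "v = 0" if "A v = 0" for v
      using that by (auto simp: A_def contact_def vec_eq_iff forall_3)
    show "koranyi (A (a - p)) (A (b - p)) = koranyi a b" for a b
      unfolding koranyi_twist twist by (simp add: A_def add.commute)
  qed (use False in \<open>simp_all add: A_def\<close>)
qed

lemma kernel_line:
  fixes l :: "real^2 \<Rightarrow> real"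
  assumes l: "linear l" and h: "l h \<noteq> 0"
  obtains v where "v \<noteq> 0" "l v = 0" "\<And>k. l k = 0 \<Longrightarrow> \<exists>\<mu>. k = \<mu> *\<^sub>R v"
proof -
  define p q where "p = l (axis 1 1)" and "q = l (axis 2 1)"
  have expand: "l k = k$1 * p + k$2 * q" for k
  proof -
    have "k = k$1 *\<^sub>R axis 1 1 + k$2 *\<^sub>R axis 2 1"
      by (simp add: vec_eq_iff forall_2 axis_def)
    then have "l k = l (k$1 *\<^sub>R axis 1 1 + k$2 *\<^sub>R axis 2 1)" by simp
    then show ?thesis by (simp add: linear_add[OF l] linear_scale[OF l] p_def q_def)
  qed
  have pq: "p \<noteq> 0 \<or> q \<noteq> 0" using h expand by auto
  define v :: "real^2" where "v = vector [q, - p]"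
  show ?thesis
  proof
    show "v \<noteq> 0" using pq by (auto simp: v_def vec_eq_iff forall_2)
    show "l v = 0" by (simp add: expand v_def)
    show "\<exists>\<mu>. k = \<mu> *\<^sub>R v" if "l k = 0" for k
    proof (cases "q = 0")
      case True
      then have "k = (- k$2 / p) *\<^sub>R v"
        using that pq by (simp add: expand v_def vec_eq_iff forall_2)
      then show ?thesis ..
    next
      case False
      then have "k = (k$1 / q) *\<^sub>R v"
        using that by (simp add: expand v_def vec_eq_iff forall_2 field_simps)
      then show ?thesis ..
    qed
  qed
qed

definition locally_embeds :: "('a::euclidean_space \<Rightarrow> real^3) \<Rightarrow> 'a set \<Rightarrow> 'a \<Rightarrow> bool" where
  "locally_embeds \<phi> W w0 \<longleftrightarrow> (\<exists>\<rho>>0. \<exists>F :: 'a \<Rightarrow> real^4. ball w0 \<rho> \<subseteq> W \<and>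
     (\<forall>a\<in>ball w0 \<rho>. \<forall>b\<in>ball w0 \<rho>. koranyi (\<phi> a) (\<phi> b) / 200 \<le> dist (F a) (F b) \<and>
        dist (F a) (F b) \<le> 200 * koranyi (\<phi> a) (\<phi> b)))"

text \<open>One reduction for curves and surfaces. \<open>B\<close> carries the two patch parameters
  to the parameters of the immersion, and \<open>E\<close> adds the directions of the cylinder.
  \<open>J\<close> is a right inverse of \<open>B\<close> with values in the kernel of
  \<open>E\<close>, so along it the patch is the given immersion moved by \<open>A\<close>.\<close>

lemma immersion_patch_embedding:
  fixes \<phi> :: "'a::euclidean_space \<Rightarrow> real^3" and A :: "real^3 \<Rightarrow> real^3" and B :: "real \<times> real \<Rightarrow> 'a"
    and E :: "real \<times> real \<Rightarrow> real^3" and J :: "'a \<Rightarrow> real \<times> real" and K :: "real \<Rightarrow> real^3"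
  assumes K: "snowflake_map K"
    and W: "open W" "w0 \<in> W"
    and deriv: "\<forall>w\<in>W. (\<phi> has_derivative \<phi>' w) (at w)"
    and lip: "\<forall>w1\<in>W. \<forall>w2\<in>W. onorm (\<lambda>v. \<phi>' w1 v - \<phi>' w2 v) \<le> C * dist w1 w2"
    and linear: "linear A" "linear B" "linear E" "linear J"
    and A: "\<And>a b. koranyi (A (a - \<phi> w0)) (A (b - \<phi> w0)) = koranyi a b"
    and normal: "\<And>s t. A (\<phi>' w0 (B (s, t))) + E (s, t) = vector [s, \<beta> * s + c * t, t]" "\<bar>\<beta>\<bar> \<le> 1"
    and J: "\<And>h. B (J h) = h" "\<And>h. E (J h) = 0"
  shows "locally_embeds \<phi> W w0"
proof -
  note bl = linear[THEN linear_conv_bounded_linear[THEN iffD1]]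
  obtain \<delta> where \<delta>: "0 < \<delta>" "ball w0 \<delta> \<subseteq> W" using W openE by blast
  obtain a where a: "0 < a" "\<And>v. norm (A v) \<le> norm v * a" using bounded_linear.pos_bounded[OF bl(1)] by blast
  obtain b where b: "0 < b" "\<And>v. norm (B v) \<le> norm v * b" using bounded_linear.pos_bounded[OF bl(2)] by blast
  obtain j where j: "0 < j" "\<And>v. norm (J v) \<le> norm v * j" using bounded_linear.pos_bounded[OF bl(4)] by blast
  define R where "R = \<delta> / b"
  have inW: "w0 + B w \<in> W" if "norm w < R" for w
  proof -
    have "norm (B w) \<le> norm w * b" by (rule b)
    also have "\<dots> < R * b" using that b by (intro mult_strict_right_mono)
    also have "\<dots> = \<delta>" using b by (simp add: R_def)
    finally show ?thesis using \<delta>(2) by (auto simp: dist_norm)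
  qed
  define \<Phi> where "\<Phi> w = A (\<phi> (w0 + B w) - \<phi> w0) + E w" for w
  define \<Phi>' where "\<Phi>' w v = A (\<phi>' (w0 + B w) (B v)) + E v" for w v
  have diff: "norm (\<phi>' x v - \<phi>' y v) \<le> \<bar>C\<bar> * norm (x - y) * norm v" if "x \<in> W" "y \<in> W" for x y v
  proof -
    have "bounded_linear (\<lambda>v. \<phi>' x v - \<phi>' y v)"
      using bspec[OF deriv that(1)] bspec[OF deriv that(2)]
      by (intro bounded_linear_sub has_derivative_bounded_linear)
    then have "norm (\<phi>' x v - \<phi>' y v) \<le> onorm (\<lambda>v. \<phi>' x v - \<phi>' y v) * norm v"
      by (rule onorm)
    also have "\<dots> \<le> (C * dist x y) * norm v" using lip that by (intro mult_right_mono) auto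
    also have "\<dots> \<le> (\<bar>C\<bar> * norm (x - y)) * norm v"
      unfolding dist_norm by (intro mult_right_mono) auto
    finally show ?thesis .
  qed
  interpret normal_patch \<Phi> \<Phi>' R "\<bar>C\<bar> * b * b * a" \<beta> c
  proof
    show "0 < R" using \<delta> b by (simp add: R_def)
    show "(\<Phi> has_derivative \<Phi>' w) (at w)" if "norm w < R" for w
    proof -
      have shift: "((\<lambda>w. w0 + B w) has_derivative B) (at w)"
        using has_derivative_add[OF has_derivative_const bounded_linear_imp_has_derivative[OF bl(2)]] by simp
      have "((\<lambda>w. \<phi> (w0 + B w)) has_derivative (\<lambda>v. \<phi>' (w0 + B w) (B v))) (at w)"
        by (rule has_derivative_compose[OF shift]) (rule bspec[OF deriv inW[OF that]])
      then have "((\<lambda>w. \<phi> (w0 + B w) - \<phi> w0) has_derivative (\<lambda>v. \<phi>' (w0 + B w) (B v))) (at w)"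
        using has_derivative_diff[OF _ has_derivative_const] by fastforce
      then have "((\<lambda>w. A (\<phi> (w0 + B w) - \<phi> w0)) has_derivative (\<lambda>v. A (\<phi>' (w0 + B w) (B v)))) (at w)"
        by (rule bounded_linear.has_derivative[OF bl(1)])
      then show ?thesis
        unfolding \<Phi>_def \<Phi>'_def
        by (rule has_derivative_add) (rule bounded_linear_imp_has_derivative[OF bl(3)])
    qed
    show "norm (\<Phi>' w v - \<Phi>' w' v) \<le> \<bar>C\<bar> * b * b * a * norm (w - w') * norm v"
      if "norm w < R" "norm w' < R" for w w' v
    proof -
      define x y where "x = w0 + B w" and "y = w0 + B w'"
      have "\<Phi>' w v - \<Phi>' w' v = A (\<phi>' x (B v) - \<phi>' y (B v))"
        by (simp add: \<Phi>'_def x_def y_def linear_diff[OF linear(1)])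
      then have "norm (\<Phi>' w v - \<Phi>' w' v) \<le> norm (\<phi>' x (B v) - \<phi>' y (B v)) * a" using a by simp
      also have "\<dots> \<le> (\<bar>C\<bar> * norm (x - y) * norm (B v)) * a"
        using a(1) inW that unfolding x_def y_def by (intro mult_right_mono diff) auto
      also have "x - y = B (w - w')" by (simp add: x_def y_def linear_diff[OF linear(2)])
      also have "(\<bar>C\<bar> * norm (B (w - w')) * norm (B v)) * a \<le>
          (\<bar>C\<bar> * (norm (w - w') * b) * (norm v * b)) * a"
        using a b by (intro mult_right_mono mult_mono) auto
      finally show ?thesis by (simp add: ac_simps)
    qed
    show "\<Phi> 0 = 0" by (simp add: \<Phi>_def linear_0[OF linear(1)] linear_0[OF linear(2)] linear_0[OF linear(3)])
    show "\<Phi>' 0 (s, t) = vector [s, \<beta> * s + c * t, t]" for s t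
      using normal(1) by (simp add: \<Phi>'_def linear_0[OF linear(2)])
  qed (rule normal(2))
  obtain F :: "real \<times> real \<Rightarrow> real^4" and \<rho> where F: "0 < \<rho>"
    "\<And>a b. norm a < \<rho> \<Longrightarrow> norm b < \<rho> \<Longrightarrow> koranyi (\<Phi> a) (\<Phi> b) / 200 \<le> dist (F a) (F b)"
    "\<And>a b. norm a < \<rho> \<Longrightarrow> norm b < \<rho> \<Longrightarrow> dist (F a) (F b) \<le> 200 * koranyi (\<Phi> a) (\<Phi> b)"
    using patch_embedding[OF K] by metis
  have \<Phi>J: "\<Phi> (J (x - w0)) = A (\<phi> x - \<phi> w0)" for x by (simp add: \<Phi>_def J)
  define \<rho>' where "\<rho>' = min \<delta> (\<rho> / j)"
  have small: "norm (J (x - w0)) < \<rho>" if "x \<in> ball w0 \<rho>'" for x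
  proof -
    have "norm (x - w0) < \<rho> / j" using that by (simp add: \<rho>'_def dist_norm norm_minus_commute)
    then have "norm (x - w0) * j < \<rho>" using j by (simp add: field_simps)
    then show ?thesis using j(2)[of "x - w0"] by simp
  qed
  have "\<forall>x\<in>ball w0 \<rho>'. \<forall>y\<in>ball w0 \<rho>'.
      koranyi (\<phi> x) (\<phi> y) / 200 \<le> dist (F (J (x - w0))) (F (J (y - w0))) \<and>
      dist (F (J (x - w0))) (F (J (y - w0))) \<le> 200 * koranyi (\<phi> x) (\<phi> y)"
    using F(2,3)[OF small small] unfolding \<Phi>J A by blast
  moreover have "0 < \<rho>'" "ball w0 \<rho>' \<subseteq> W" using \<delta> F(1) j by (auto simp: \<rho>'_def)
  ultimately show ?thesis
    unfolding locally_embeds_def by (intro exI[of _ \<rho>'] conjI exI[of _ "\<lambda>x. F (J (x - w0))"])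
qed

lemma curve_embedding:
  fixes K :: "real \<Rightarrow> real^3" and W :: "real set"
  assumes K: "snowflake_map K"
    and chart: "c11_chart M V W \<phi> \<phi>'" and w0: "w0 \<in> W"
  shows "locally_embeds \<phi> W w0"
proof -
  from chart obtain C where W: "open W" and deriv: "\<forall>w\<in>W. (\<phi> has_derivative \<phi>' w) (at w)"
    and inj: "inj (\<phi>' w0)"
    and lip: "\<forall>w1\<in>W. \<forall>w2\<in>W. onorm (\<lambda>v. \<phi>' w1 v - \<phi>' w2 v) \<le> C * dist w1 w2"
    using w0 unfolding c11_chart_def by blast
  have lin: "linear (\<phi>' w0)" using bspec[OF deriv w0] has_derivative_linear by blast
  define u where "u = \<phi>' w0 1"
  obtain A :: "real^3 \<Rightarrow> real^3" where A: "linear A" "\<And>v. A v = 0 \<Longrightarrow> v = 0"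
      "\<And>a b. koranyi (A (a - \<phi> w0)) (A (b - \<phi> w0)) = koranyi a b"
      "\<bar>A u $ 2\<bar> \<le> \<bar>A u $ 1\<bar>"
    using koranyi_frame[of "\<phi> w0" u] by metis
  have "u \<noteq> \<phi>' w0 0" using inj unfolding u_def by (auto dest: injD)
  then have "A u \<noteq> 0" using A(2) linear_0[OF lin] by auto
  define m where "m = A u"
  have m: "m \<noteq> 0" "\<bar>m$2\<bar> \<le> \<bar>m$1\<bar>" using \<open>A u \<noteq> 0\<close> A(4) by (auto simp: m_def)
  have Am: "A (\<phi>' w0 h) = h *\<^sub>R m" for h
    using linear_scale[OF lin, of h 1] by (simp add: linear_scale[OF A(1)] m_def u_def)
  show ?thesis
  proof (cases "m$1 = 0")
    case False
    define B :: "real \<times> real \<Rightarrow> real" where "B w = fst w / m$1" for w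
    \<comment> \<open>The vertical cylinder: \<open>E\<close> corrects the third coordinate of the
      linear part to the second parameter. It vanishes on the tangent line of the curve, which
      \<open>J\<close> parametrises.\<close>
    define E :: "real \<times> real \<Rightarrow> real^3" where "E w = vector [0, 0, snd w - m$3 / m$1 * fst w]" for w
    define J where "J h = (m$1 * h, m$3 * h)" for h
    show ?thesis
    proof (rule immersion_patch_embedding[OF K W w0 deriv lip A(1) _ _ _ A(3)])
      show "linear B" by (rule linearI) (simp_all add: B_def add_divide_distrib)
      show "linear E"
        using False by (intro linearI) (simp_all add: E_def vec_eq_iff forall_3 field_simps)
      show "linear J" by (rule linearI) (simp_all add: J_def algebra_simps)
      show "A (\<phi>' w0 (B (s, t))) + E (s, t) = vector [s, m$2 / m$1 * s + 0 * t, t]" for s t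
        using False by (simp add: Am B_def E_def vec_eq_iff forall_3 field_simps)
      show "\<bar>m$2 / m$1\<bar> \<le> 1" using m(2) False by (simp add: abs_divide)
      show "B (J h) = h" "E (J h) = 0" for h
        using False by (simp_all add: B_def J_def E_def vec_eq_iff forall_3)
    qed
  next
    \<comment> \<open>Now \<open>m$2\<close> vanishes too, so the tangent is vertical. The added
      \<open>x\<close>-direction is the leaf direction, with slope 0.\<close>
    case True
    then have m3: "m$3 \<noteq> 0" using m by (auto simp: vec_eq_iff forall_3)
    define B :: "real \<times> real \<Rightarrow> real" where "B w = snd w / m$3" for w
    define E :: "real \<times> real \<Rightarrow> real^3" where "E w = vector [fst w, 0, 0]" for w
    define J :: "real \<Rightarrow> real \<times> real" where "J h = (0, m$3 * h)" for h
    show ?thesis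
    proof (rule immersion_patch_embedding[OF K W w0 deriv lip A(1) _ _ _ A(3)])
      show "linear B" by (rule linearI) (simp_all add: B_def add_divide_distrib)
      show "linear E" by (rule linearI) (simp_all add: E_def vec_eq_iff forall_3)
      show "linear J" by (rule linearI) (simp_all add: J_def algebra_simps)
      show "A (\<phi>' w0 (B (s, t))) + E (s, t) = vector [s, 0 * s + 0 * t, t]" for s t
        using m(2) m3 True by (simp add: Am B_def E_def vec_eq_iff forall_3)
      show "\<bar>0 :: real\<bar> \<le> 1" by simp
      show "B (J h) = h" "E (J h) = 0" for h
        using m3 by (simp_all add: B_def J_def E_def vec_eq_iff forall_3)
    qed
  qed
qed

lemma surface_embedding:
  fixes K :: "real \<Rightarrow> real^3" and W :: "(real^2) set"
  assumes K: "snowflake_map K"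
    and chart: "c11_chart M V W \<phi> \<phi>'" and w0: "w0 \<in> W"
    and regular: "range (\<phi>' w0) \<noteq> horizontal_plane (\<phi> w0)"
  shows "locally_embeds \<phi> W w0"
proof -
  from chart obtain C where W: "open W" and deriv: "\<forall>w\<in>W. (\<phi> has_derivative \<phi>' w) (at w)"
    and inj: "inj (\<phi>' w0)"
    and lip: "\<forall>w1\<in>W. \<forall>w2\<in>W. onorm (\<lambda>v. \<phi>' w1 v - \<phi>' w2 v) \<le> C * dist w1 w2"
    using w0 unfolding c11_chart_def by blast
  define D where "D = \<phi>' w0"
  have lin: "linear D" using bspec[OF deriv w0] has_derivative_linear unfolding D_def by blast
  have contact_linear: "linear (\<lambda>h. contact (\<phi> w0) (D h))"
    by (rule linearI) (simp_all add: contact_def linear_add[OF lin] linear_scale[OF lin] field_simps)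
  obtain h where h: "contact (\<phi> w0) (D h) \<noteq> 0"
  proof -
    \<comment> \<open>If the contact form vanished on the tangent plane, that plane would lie in the
      horizontal plane and, by dimension, equal it.\<close>
    have "\<not> (\<forall>h. contact (\<phi> w0) (D h) = 0)"
    proof
      assume "\<forall>h. contact (\<phi> w0) (D h) = 0"
      then have sub: "range D \<subseteq> horizontal_plane (\<phi> w0)" using contact_zero_horizontal by auto
      have "dim (range D) = dim (UNIV :: (real^2) set)"
        using inj lin unfolding D_def by (intro dim_image_eq) auto
      moreover have "dim (horizontal_plane (\<phi> w0)) \<le> 2"
        unfolding horizontal_plane_def dim_span by (rule order_trans[OF dim_le_card']) (auto simp: card_insert_if)
      ultimately have "range D = horizontal_plane (\<phi> w0)"
        using sub lin unfolding horizontal_plane_def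
        by (intro subspace_dim_equal) (auto simp: linear_subspace_image)
      then show False using regular unfolding D_def by simp
    qed
    then show ?thesis using that by blast
  qed
  obtain v where v: "v \<noteq> 0" "contact (\<phi> w0) (D v) = 0"
    "\<And>k. contact (\<phi> w0) (D k) = 0 \<Longrightarrow> \<exists>\<mu>. k = \<mu> *\<^sub>R v"
    by (rule kernel_line[OF contact_linear h]) blast
  obtain A :: "real^3 \<Rightarrow> real^3" where A: "linear A" "\<And>v. A v = 0 \<Longrightarrow> v = 0"
      "\<And>a b. koranyi (A (a - \<phi> w0)) (A (b - \<phi> w0)) = koranyi a b"
      "\<And>v. A v $ 3 = 0 \<longleftrightarrow> contact (\<phi> w0) v = 0"
      "\<bar>A (D v) $ 2\<bar> \<le> \<bar>A (D v) $ 1\<bar>"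
    using koranyi_frame[of "\<phi> w0" "D v"] by metis
  define n where "n h = A (D h)" for h
  have n: "linear n" unfolding n_def using linear_compose[OF lin A(1)] by (simp add: o_def)
  note n_simps = linear_add[OF n] linear_scale[OF n] linear_diff[OF n]
  have n3: "n h $ 3 = 0 \<longleftrightarrow> contact (\<phi> w0) (D h) = 0" for h by (simp add: n_def A)
  have "D v \<noteq> D 0" using v(1) inj unfolding D_def by (auto dest: injD)
  then have "n v \<noteq> 0" using A(2) linear_0[OF lin] unfolding n_def by auto
  then have nv: "n v $ 3 = 0" "n v $ 1 \<noteq> 0" "\<bar>n v $ 2\<bar> \<le> \<bar>n v $ 1\<bar>"
    using A(5) v(2) n3[of v] by (auto simp: vec_eq_iff forall_3 n_def)
  \<comment> \<open>The normal form: \<open>e\<close> is the horizontal tangent direction scaled to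
    first coordinate 1, \<open>k\<close> a transversal one scaled to third coordinate 1, and
    \<open>f\<close> is \<open>k\<close> with its first coordinate cleared by means of
    \<open>e\<close>.\<close>
  define e where "e = (1 / n v $ 1) *\<^sub>R v"
  define \<beta> where "\<beta> = n v $ 2 / n v $ 1"
  have e: "n e = vector [1, \<beta>, 0]"
    using nv by (simp add: e_def n_simps vec_eq_iff forall_3 \<beta>_def)
  define k where "k = (1 / n h $ 3) *\<^sub>R h"
  have k: "n k $ 3 = 1" using h n3 by (simp add: k_def n_simps)
  define f where "f = k - (n k $ 1) *\<^sub>R e"
  define c where "c = n f $ 2"
  have f: "n f = vector [0, c, 1]"
    by (simp add: vec_eq_iff forall_3 c_def) (simp add: f_def n_simps e k)
  define B where "B w = fst w *\<^sub>R e + snd w *\<^sub>R f" for w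
  define J where "J h = (n h $ 1, n h $ 3)" for h
  have nB: "n (B (s, t)) = vector [s, \<beta> * s + c * t, t]" for s t
    by (simp add: B_def n_simps e f vec_eq_iff forall_3 mult.commute)
  have BJ: "B (J x) = x" for x
  proof -
    \<comment> \<open>The defect \<open>y\<close> is annihilated by the contact form, hence a
      multiple of \<open>v\<close>; its first coordinate in the frame is 0 while that of
      \<open>v\<close> is not.\<close>
    define y where "y = x - B (J x)"
    have y: "n y $ 1 = 0" "n y $ 3 = 0" by (simp_all add: y_def n_simps J_def nB)
    then obtain \<mu> where \<mu>: "y = \<mu> *\<^sub>R v" using v(3) n3 by blast
    then have "\<mu> = 0" using y(1) nv(2) by (simp add: n_simps)
    then show ?thesis using \<mu> by (simp add: y_def)
  qed
  show ?thesis
  proof (rule immersion_patch_embedding[OF K W w0 deriv lip A(1) _ _ _ A(3)])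
    show "linear B" by (rule linearI) (simp_all add: B_def algebra_simps)
    show "linear (\<lambda>_::real \<times> real. 0 :: real^3)" by (rule linearI) simp_all
    show "linear J" by (rule linearI) (simp_all add: J_def n_simps)
    show "A (\<phi>' w0 (B (s, t))) + 0 = vector [s, \<beta> * s + c * t, t]" for s t
      using nB[of s t] by (simp add: n_def D_def)
    show "\<bar>\<beta>\<bar> \<le> 1" using nv by (simp add: \<beta>_def abs_divide)
    show "B (J h) = h" "(0 :: real^3) = 0" for h using BJ by simp_all
  qed
qed

text \<open>The embedding lives on parameters and is carried to the manifold by the inverse of the
  chart. Nonemptiness of the set of constants is recorded because the infimum of an empty set of
  reals would carry no information.\<close>

lemma chart_neighbourhood:
  fixes \<phi> :: "'a::euclidean_space \<Rightarrow> real^3"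
  assumes chart: "c11_chart M V W \<phi> \<phi>'" and "locally_embeds \<phi> W w0"
  shows "\<exists>U. openin (top_of_set M) U \<and> \<phi> w0 \<in> U \<and>
    {L'. \<exists>f. bilipschitz_K U L' f} \<noteq> {} \<and> Lip_K_R4 U \<le> 200"
proof -
  obtain \<rho> and F :: "'a \<Rightarrow> real^4" where \<rho>: "0 < \<rho>" "ball w0 \<rho> \<subseteq> W"
    and F: "\<forall>a\<in>ball w0 \<rho>. \<forall>b\<in>ball w0 \<rho>. koranyi (\<phi> a) (\<phi> b) / 200 \<le> dist (F a) (F b) \<and>
      dist (F a) (F b) \<le> 200 * koranyi (\<phi> a) (\<phi> b)"
    using assms(2) unfolding locally_embeds_def by blast
  obtain \<psi> where hom: "homeomorphism W (M \<inter> V) \<phi> \<psi>" and V: "open V"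
    using chart unfolding c11_chart_def by blast
  define U where "U = \<phi> ` ball w0 \<rho>"
  have "openin (top_of_set W) (ball w0 \<rho>)" using \<rho>(2) by (simp add: open_subset)
  then have "openin (top_of_set (M \<inter> V)) U"
    unfolding U_def by (rule homeomorphism_imp_open_map[OF hom])
  moreover have "openin (top_of_set M) (M \<inter> V)" using V by (rule openin_open_Int)
  ultimately have op: "openin (top_of_set M) U" by (rule openin_trans)
  have \<psi>: "\<psi> (\<phi> a) = a" if "a \<in> ball w0 \<rho>" for a
    using hom that \<rho>(2) unfolding homeomorphism_def by auto
  have bl: "bilipschitz_K U 200 (F \<circ> \<psi>)"
    unfolding bilipschitz_K_def U_def using F by (auto simp: \<psi>)
  have "Lip_K_R4 U \<le> 200"
    unfolding Lip_K_R4_def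
  proof (rule cInf_lower)
    show "200 \<in> {L. \<exists>f. bilipschitz_K U L f}" using bl by blast
    show "bdd_below {L. \<exists>f. bilipschitz_K U L f}"
      by (rule bdd_belowI[of _ 0]) (auto simp: bilipschitz_K_def)
  qed
  moreover have "\<phi> w0 \<in> U" using \<rho>(1) by (simp add: U_def)
  ultimately show ?thesis using op bl by blast
qed

lemma chart_parameter:
  assumes "c11_chart M V W \<phi> \<phi>'" "p \<in> M" "p \<in> V"
  obtains w0 where "w0 \<in> W" "\<phi> w0 = p"
  using assms unfolding c11_chart_def homeomorphism_def by blast

theorem theorem1p3:
  shows "\<exists>L>1.
    (\<forall>\<gamma> x. c11_curve \<gamma> \<and> x \<in> \<gamma> \<longrightarrow>
       (\<exists>U. openin (top_of_set \<gamma>) U \<and> x \<in> U \<and>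
            {L'. \<exists>f. bilipschitz_K U L' f} \<noteq> {} \<and> Lip_K_R4 U \<le> L)) \<and>
    (\<forall>M x. c11_surface M \<and> x \<in> M \<and> H_regular M x \<longrightarrow>
       (\<exists>U. openin (top_of_set M) U \<and> x \<in> U \<and>
            {L'. \<exists>f. bilipschitz_K U L' f} \<noteq> {} \<and> Lip_K_R4 U \<le> L))"
proof -
  obtain K where K: "snowflake_map K" using snowflake_map_exists ..
  show ?thesis
  proof (intro exI[of _ 200] conjI allI impI)
    fix \<gamma> x assume "c11_curve \<gamma> \<and> x \<in> \<gamma>"
    then obtain V and W :: "real set" and \<phi> \<phi>' where x: "x \<in> \<gamma>" "x \<in> V" and chart: "c11_chart \<gamma> V W \<phi> \<phi>'"
      unfolding c11_curve_def by blast
    obtain w0 where w0: "w0 \<in> W" "\<phi> w0 = x" using chart_parameter[OF chart x] .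
    show "\<exists>U. openin (top_of_set \<gamma>) U \<and> x \<in> U \<and>
        {L'. \<exists>f. bilipschitz_K U L' f} \<noteq> {} \<and> Lip_K_R4 U \<le> 200"
      unfolding w0(2)[symmetric]
      by (rule chart_neighbourhood[OF chart curve_embedding[OF K chart w0(1)]])
  next
    fix M x assume M: "c11_surface M \<and> x \<in> M \<and> H_regular M x"
    then obtain V and W :: "(real^2) set" and \<phi> \<phi>' where x: "x \<in> M" "x \<in> V" and chart: "c11_chart M V W \<phi> \<phi>'"
      unfolding c11_surface_def by blast
    obtain w0 where w0: "w0 \<in> W" "\<phi> w0 = x" using chart_parameter[OF chart x] .
    \<comment> \<open>\<open>characteristic\<close> asks for some chart with horizontal tangent
      plane, so its negation applies to the chart at hand.\<close>
    have regular: "range (\<phi>' w0) \<noteq> horizontal_plane (\<phi> w0)"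
      using M chart w0 unfolding H_regular_def characteristic_def by blast
    show "\<exists>U. openin (top_of_set M) U \<and> x \<in> U \<and>
        {L'. \<exists>f. bilipschitz_K U L' f} \<noteq> {} \<and> Lip_K_R4 U \<le> 200"
      unfolding w0(2)[symmetric]
      by (rule chart_neighbourhood[OF chart surface_embedding[OF K chart w0(1) regular]])
  qed simp
qed

end
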